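(* Let $n\geq 1$ and let $\mathbb{K}$ be a field. (i) For any $X\subseteq\{1,2,\dots,n\}$ the map $\rho_X$ gives an irreducible representation of $\mathbb{K}\mathrm{K}_n$. (ii) The representations $\rho_X$, $X\subseteq\{1,2,\dots,n\}$, are pairwise non-equivalent and constitute an exhaustive list of irreducible representations of $\mathbb{K}\mathrm{K}_n$ (up to equivalence). In particular, $\mathbb{K}\mathrm{K}_n$ has $2^n$ non-equivalent irreducible representations. (iii) $\rho_X$ is a representation of $\overline{\mathbb{K}\mathrm{K}}_n$ if and only if $X\neq\{1,2,\dots,n\}$. In particular, $\overline{\mathbb{K}\mathrm{K}}_n$ has $2^n-1$ non-equivalent irreducible representations.
   Context: For a positive integer $n$, Kiselman's semigroup $\mathrm{K}_n$ is the monoid (with unit element $e$) given by the monoid presentation with generators $a_1,\dots,a_n$ and relations $a_i^2=a_i$ for $i=1,\dots,n$, and $a_ia_ja_i=a_ja_ia_j=a_ja_i$ for all $1\leq i<j\leq n$. The element $e_{\{1,\dots,n\}}=a_na_{n-1}\cdots a_1$ is the zero element of the semigroup $\mathrm{K}_n$. The content $\mathfrak{c}(w)$ of an element $w\in\mathrm{K}_n$ is the set of all $i\in\{1,\dots,n\}$ such that $a_i$ appears in a word in the generators representing $w$; this does not depend on the chosen word. $\mathbb{K}\mathrm{K}_n$ denotes the semigroup algebra of $\mathrm{K}_n$ over $\mathbb{K}$, and $\overline{\mathbb{K}\mathrm{K}}_n$ denotes the quotient of $\mathbb{K}\mathrm{K}_n$ modulo the ideal generated by the basis element $e_{\{1,\dots,n\}}$.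 For $X\subseteq\{1,\dots,n\}$ the map $\rho_X:\mathrm{K}_n\to\mathbb{K}$ is defined by $\rho_X(w)=1$ if $\mathfrak{c}(w)\subseteq X$ and $\rho_X(w)=0$ otherwise; it is extended linearly to $\mathbb{K}\mathrm{K}_n$. In (iii), $\rho_X$ is a representation of $\overline{\mathbb{K}\mathrm{K}}_n$ if it factors through the quotient map. *)

theory Defs
  imports "HOL-Library.FuncSet" "HOL-Library.Equipollence" "HOL-Algebra.Module" "HOL-Algebra.QuotRing"
begin

inductive_set presented_cong :: "'l set \<Rightarrow> ('l list \<times> 'l list) set \<Rightarrow> ('l list \<times> 'l list) set"
  for S :: "'l set" and R :: "('l list \<times> 'l list) set"
where
  base: "(u, v) \<in> R \<Longrightarrow> u \<in> lists S \<Longrightarrow> v \<in> lists S \<Longrightarrow> (u, v) \<in> presented_cong S R"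
| refl: "u \<in> lists S \<Longrightarrow> (u, u) \<in> presented_cong S R"
| sym: "(u, v) \<in> presented_cong S R \<Longrightarrow> (v, u) \<in> presented_cong S R"
| trans: "(u, v) \<in> presented_cong S R \<Longrightarrow> (v, w) \<in> presented_cong S R
    \<Longrightarrow> (u, w) \<in> presented_cong S R"
| append: "(u, v) \<in> presented_cong S R \<Longrightarrow> (u', v') \<in> presented_cong S R
    \<Longrightarrow> (u @ u', v @ v') \<in> presented_cong S R"

definition presented_monoid :: "'l set \<Rightarrow> ('l list \<times> 'l list) set \<Rightarrow> 'l list set monoid" where
  "presented_monoid S R =
    \<lparr>carrier = lists S // presented_cong S R,
     mult = (\<lambda>C D. \<Union>u\<in>C. \<Union>v\<in>D. presented_cong S R `` {u @ v}),
     one = presented_cong S R `` {[]}\<rparr>"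

text \<open>The generator \<open>a\<^sub>i\<close> is the letter \<open>i\<close>.\<close>

definition kiselman_rels :: "nat \<Rightarrow> (nat list \<times> nat list) set" where
  "kiselman_rels n =
     {([i, i], [i]) | i. i \<in> {1..n}}
   \<union> {([i, j, i], [j, i]) | i j. 1 \<le> i \<and> i < j \<and> j \<le> n}
   \<union> {([j, i, j], [j, i]) | i j. 1 \<le> i \<and> i < j \<and> j \<le> n}"

definition kiselman :: "nat \<Rightarrow> nat list set monoid" where
  "kiselman n = presented_monoid {1..n} (kiselman_rels n)"

definition kiselman_zero :: "nat \<Rightarrow> nat list set" where
  "kiselman_zero n = presented_cong {1..n} (kiselman_rels n) `` {rev [1..<Suc n]}"

text \<open>An element of \<^term>\<open>kiselman n\<close> is the set of all words representing it.\<close>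

definition content :: "nat \<Rightarrow> nat list set \<Rightarrow> nat set" where
  "content n w = {i \<in> {1..n}. \<exists>u\<in>w. i \<in> set u}"

definition msupp :: "('k, 'c) ring_scheme \<Rightarrow> ('m, 'd) monoid_scheme \<Rightarrow> ('m \<Rightarrow> 'k) \<Rightarrow> 'm set" where
  "msupp K M f = {x \<in> carrier M. f x \<noteq> \<zero>\<^bsub>K\<^esub>}"

definition monoid_algebra ::
  "('k, 'c) ring_scheme \<Rightarrow> ('m, 'd) monoid_scheme \<Rightarrow> ('k, 'm \<Rightarrow> 'k) module" where
  "monoid_algebra K M =
    \<lparr>carrier = {f \<in> carrier M \<rightarrow>\<^sub>E carrier K. finite (msupp K M f)},
     mult = (\<lambda>f g. \<lambda>x\<in>carrier M.
       finsum K (\<lambda>(y, z). f y \<otimes>\<^bsub>K\<^esub> g z)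
         {(y, z). y \<in> msupp K M f \<and> z \<in> msupp K M g \<and> y \<otimes>\<^bsub>M\<^esub> z = x}),
     one = (\<lambda>x\<in>carrier M. if x = \<one>\<^bsub>M\<^esub> then \<one>\<^bsub>K\<^esub> else \<zero>\<^bsub>K\<^esub>),
     zero = (\<lambda>x\<in>carrier M. \<zero>\<^bsub>K\<^esub>),
     add = (\<lambda>f g. \<lambda>x\<in>carrier M. f x \<oplus>\<^bsub>K\<^esub> g x),
     smult = (\<lambda>c f. \<lambda>x\<in>carrier M. c \<otimes>\<^bsub>K\<^esub> f x)\<rparr>"

definition basis_elem ::
  "('k, 'c) ring_scheme \<Rightarrow> ('m, 'd) monoid_scheme \<Rightarrow> 'm \<Rightarrow> ('m \<Rightarrow> 'k)" where
  "basis_elem K M w = (\<lambda>x\<in>carrier M. if x = w then \<one>\<^bsub>K\<^esub> else \<zero>\<^bsub>K\<^esub>)"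

definition linear_extension ::
  "('k, 'c) ring_scheme \<Rightarrow> ('m, 'd) monoid_scheme \<Rightarrow> ('m \<Rightarrow> 'k) \<Rightarrow> ('m \<Rightarrow> 'k) \<Rightarrow> 'k" where
  "linear_extension K M \<rho> f = finsum K (\<lambda>w. f w \<otimes>\<^bsub>K\<^esub> \<rho> w) (msupp K M f)"

text \<open>\<^const>\<open>FactRing\<close> carries no scalar multiplication; the field \<open>smult\<close> below is the
  induced one, \<open>c (I + a) = I + c a\<close>.\<close>

definition quotient_algebra ::
  "('k, 'a, 'd) module_scheme \<Rightarrow> 'a set \<Rightarrow> ('k, 'a set) module" where
  "quotient_algebra A I =
    ring.extend (A Quot I)
      (module.fields (\<lambda>c C. \<Union>a\<in>C. I +>\<^bsub>A\<^esub> (c \<odot>\<^bsub>A\<^esub> a)))"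

text \<open>The fields \<open>mult\<close> and \<open>one\<close> of a vector space \<open>V\<close> over \<open>K\<close> are irrelevant.\<close>

locale representation =
  field K + module K V
  for K :: "('k, 'c) ring_scheme" and A :: "('k, 'a, 'd) module_scheme"
    and V :: "('k, 'v, 'e) module_scheme" and \<phi> :: "'a \<Rightarrow> 'v \<Rightarrow> 'v" +
  assumes act_closed: "\<lbrakk>a \<in> carrier A; v \<in> carrier V\<rbrakk> \<Longrightarrow> \<phi> a v \<in> carrier V"
    and act_add: "\<lbrakk>a \<in> carrier A; v \<in> carrier V; w \<in> carrier V\<rbrakk>
      \<Longrightarrow> \<phi> a (v \<oplus>\<^bsub>V\<^esub> w) = \<phi> a v \<oplus>\<^bsub>V\<^esub> \<phi> a w"
    and act_smult: "\<lbrakk>a \<in> carrier A; c \<in> carrier K; v \<in> carrier V\<rbrakk>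
      \<Longrightarrow> \<phi> a (c \<odot>\<^bsub>V\<^esub> v) = c \<odot>\<^bsub>V\<^esub> \<phi> a v"
    and add_act: "\<lbrakk>a \<in> carrier A; b \<in> carrier A; v \<in> carrier V\<rbrakk>
      \<Longrightarrow> \<phi> (a \<oplus>\<^bsub>A\<^esub> b) v = \<phi> a v \<oplus>\<^bsub>V\<^esub> \<phi> b v"
    and smult_act: "\<lbrakk>c \<in> carrier K; a \<in> carrier A; v \<in> carrier V\<rbrakk>
      \<Longrightarrow> \<phi> (c \<odot>\<^bsub>A\<^esub> a) v = c \<odot>\<^bsub>V\<^esub> \<phi> a v"
    and mult_act: "\<lbrakk>a \<in> carrier A; b \<in> carrier A; v \<in> carrier V\<rbrakk>
      \<Longrightarrow> \<phi> (a \<otimes>\<^bsub>A\<^esub> b) v = \<phi> a (\<phi> b v)"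
    and one_act: "v \<in> carrier V \<Longrightarrow> \<phi> \<one>\<^bsub>A\<^esub> v = v"

locale irreducible_representation =
  representation K A V \<phi>
  for K :: "('k, 'c) ring_scheme" and A :: "('k, 'a, 'd) module_scheme"
    and V :: "('k, 'v, 'e) module_scheme" and \<phi> :: "'a \<Rightarrow> 'v \<Rightarrow> 'v" +
  assumes nonzero: "carrier V \<noteq> {\<zero>\<^bsub>V\<^esub>}"
    and no_invariant_subspace:
      "\<lbrakk>submodule W K V; \<And>a w. \<lbrakk>a \<in> carrier A; w \<in> W\<rbrakk> \<Longrightarrow> \<phi> a w \<in> W\<rbrakk>
        \<Longrightarrow> W = {\<zero>\<^bsub>V\<^esub>} \<or> W = carrier V"

definition rep_equivalent ::
  "('k, 'c) ring_scheme \<Rightarrow> ('k, 'a, 'd) module_scheme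
    \<Rightarrow> ('k, 'v, 'e) module_scheme \<Rightarrow> ('a \<Rightarrow> 'v \<Rightarrow> 'v)
    \<Rightarrow> ('k, 'w, 'f) module_scheme \<Rightarrow> ('a \<Rightarrow> 'w \<Rightarrow> 'w) \<Rightarrow> bool" where
  "rep_equivalent K A V \<phi> W \<psi> \<longleftrightarrow>
    (\<exists>T. bij_betw T (carrier V) (carrier W)
      \<and> (\<forall>v\<in>carrier V. \<forall>v'\<in>carrier V. T (v \<oplus>\<^bsub>V\<^esub> v') = T v \<oplus>\<^bsub>W\<^esub> T v')
      \<and> (\<forall>c\<in>carrier K. \<forall>v\<in>carrier V. T (c \<odot>\<^bsub>V\<^esub> v) = c \<odot>\<^bsub>W\<^esub> T v)
      \<and> (\<forall>a\<in>carrier A. \<forall>v\<in>carrier V. T (\<phi> a v) = \<psi> a (T v)))"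

text \<open>HOL has no collection of all vector spaces, so the classes are formed among the spaces with
  carrier in the type \<open>'v\<close>. A type too small to carry a copy of some irreducible
  representation misses its class.\<close>

definition irrep_classes ::
  "('k, 'c) ring_scheme \<Rightarrow> ('k, 'a, 'd) module_scheme \<Rightarrow> 'v itself
    \<Rightarrow> (('k, 'v) module \<times> ('a \<Rightarrow> 'v \<Rightarrow> 'v)) set set" where
  "irrep_classes K A _ =
    {(V, \<phi>). irreducible_representation K A V \<phi>} //
    {((V, \<phi>), (W, \<psi>)). irreducible_representation K A V \<phi>
        \<and> irreducible_representation K A W \<psi> \<and> rep_equivalent K A V \<phi> W \<psi>}"

definition factors_through_quotient ::
  "('k, 'c) ring_scheme \<Rightarrow> ('k, 'a, 'd) module_scheme \<Rightarrow> 'a set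
    \<Rightarrow> ('k, 'v, 'e) module_scheme \<Rightarrow> ('a \<Rightarrow> 'v \<Rightarrow> 'v) \<Rightarrow> bool" where
  "factors_through_quotient K A I V \<phi> \<longleftrightarrow>
    (\<exists>\<psi>. representation K (quotient_algebra A I) V \<psi>
      \<and> (\<forall>a\<in>carrier A. \<forall>v\<in>carrier V. \<psi> (I +>\<^bsub>A\<^esub> a) v = \<phi> a v))"

definition self_module :: "('k, 'c) ring_scheme \<Rightarrow> ('k, 'k) module" where
  "self_module K =
    \<lparr>carrier = carrier K, mult = mult K, one = \<one>\<^bsub>K\<^esub>, zero = \<zero>\<^bsub>K\<^esub>, add = add K,
     smult = mult K\<rparr>"

definition kiselman_algebra :: "('k, 'c) ring_scheme \<Rightarrow> nat \<Rightarrow> ('k, nat list set \<Rightarrow> 'k) module" where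
  "kiselman_algebra K n = monoid_algebra K (kiselman n)"

definition zero_ideal :: "('k, 'c) ring_scheme \<Rightarrow> nat \<Rightarrow> (nat list set \<Rightarrow> 'k) set" where
  "zero_ideal K n =
    Idl\<^bsub>kiselman_algebra K n\<^esub> {basis_elem K (kiselman n) (kiselman_zero n)}"

definition kiselman_algebra_bar ::
  "('k, 'c) ring_scheme \<Rightarrow> nat \<Rightarrow> ('k, (nat list set \<Rightarrow> 'k) set) module" where
  "kiselman_algebra_bar K n = quotient_algebra (kiselman_algebra K n) (zero_ideal K n)"

definition rho :: "('k, 'c) ring_scheme \<Rightarrow> nat \<Rightarrow> nat set \<Rightarrow> nat list set \<Rightarrow> 'k" where
  "rho K n X w = (if content n w \<subseteq> X then \<one>\<^bsub>K\<^esub> else \<zero>\<^bsub>K\<^esub>)"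

definition rho_rep ::
  "('k, 'c) ring_scheme \<Rightarrow> nat \<Rightarrow> nat set \<Rightarrow> (nat list set \<Rightarrow> 'k) \<Rightarrow> 'k \<Rightarrow> 'k" where
  "rho_rep K n X f v = linear_extension K (kiselman n) (rho K n X) f \<otimes>\<^bsub>K\<^esub> v"

end

(* In an irreducible representation of K_n every a_i acts as 0 or as the identity: by induction
   on i, the image of a_i is invariant, since a_j with j < i acts as a scalar and
   a_j a_i = a_i a_j a_i for j > i, while a_i is idempotent. So all elements of K_n act as
   scalars, the space is a line, and the action is rho_X for the set X of those i with a_i acting
   as the identity. The representations that factor through the quotient are those that kill the
   zero element, and rho_X kills it unless X = {1..n}. *)

theory Submission
  imports Defs
begin

text \<open>The induction has to run upwards: for \<open>j < i\<close> the relations do not place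
  \<open>a_j a_i v\<close> in the image of \<open>a_i\<close>, so \<open>a_j\<close> must already be
  under control at that stage. Idempotence forces the scalars to be 0 or 1, so no eigenvalue has to
  exist in the field. Two things surround this argument. The algebra consists of finitely supported
  functions with a convolution product. Its laws are not proved by rearranging sums in each case: a
  coordinate is the linear extension of a coordinate functional, and extending a function to a
  product is an iterated extension, so every law turns into an identity between values at monoid
  elements. The same formula makes the extended \<open>rho\<close> multiplicative. Further,
  equivalence classes are counted among spaces with carrier in a fixed type, so the one-dimensional
  space \<open>K\<close> is first copied into that type along an injection.\<close>

section \<open>The algebra of a monoid over a commutative ring\<close>

lemma carrier_monoid_algebra:
  "f \<in> carrier (monoid_algebra K M)
    \<longleftrightarrow> f \<in> carrier M \<rightarrow>\<^sub>E carrier K \<and> finite (msupp K M f)"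
  unfolding monoid_algebra_def by simp

lemma add_monoid_algebra:
  "x \<in> carrier M \<Longrightarrow> (f \<oplus>\<^bsub>monoid_algebra K M\<^esub> g) x = f x \<oplus>\<^bsub>K\<^esub> g x"
  unfolding monoid_algebra_def by simp

lemma smult_monoid_algebra:
  "x \<in> carrier M \<Longrightarrow> (c \<odot>\<^bsub>monoid_algebra K M\<^esub> f) x = c \<otimes>\<^bsub>K\<^esub> f x"
  unfolding monoid_algebra_def by simp

lemma zero_monoid_algebra:
  "x \<in> carrier M \<Longrightarrow> \<zero>\<^bsub>monoid_algebra K M\<^esub> x = \<zero>\<^bsub>K\<^esub>"
  unfolding monoid_algebra_def by simp

lemma one_monoid_algebra: "\<one>\<^bsub>monoid_algebra K M\<^esub> = basis_elem K M \<one>\<^bsub>M\<^esub>"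
  unfolding monoid_algebra_def basis_elem_def by simp

lemma mult_monoid_algebra:
  "x \<in> carrier M \<Longrightarrow> (f \<otimes>\<^bsub>monoid_algebra K M\<^esub> g) x =
    finsum K (\<lambda>(y, z). f y \<otimes>\<^bsub>K\<^esub> g z)
      {p \<in> msupp K M f \<times> msupp K M g. fst p \<otimes>\<^bsub>M\<^esub> snd p = x}"
  unfolding monoid_algebra_def
  by (auto intro!: arg_cong[where f = "finsum K _"])

lemma monoid_algebra_extensional:
  "(f \<oplus>\<^bsub>monoid_algebra K M\<^esub> g) \<in> extensional (carrier M)"
  "(f \<otimes>\<^bsub>monoid_algebra K M\<^esub> g) \<in> extensional (carrier M)"
  "(c \<odot>\<^bsub>monoid_algebra K M\<^esub> g) \<in> extensional (carrier M)"
  "\<zero>\<^bsub>monoid_algebra K M\<^esub> \<in> extensional (carrier M)"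
  unfolding monoid_algebra_def by simp_all

locale coefficients_and_monoid = K?: cring K + M?: Group.monoid M
  for K :: "('k, 'c) ring_scheme" and M :: "('m, 'd) monoid_scheme"
begin

abbreviation A where "A \<equiv> monoid_algebra K M"

lemma A_closed [simp]: "f \<in> carrier A \<Longrightarrow> x \<in> carrier M \<Longrightarrow> f x \<in> carrier K"
  unfolding carrier_monoid_algebra by auto

lemma finite_msupp [simp]: "f \<in> carrier A \<Longrightarrow> finite (msupp K M f)"
  unfolding carrier_monoid_algebra by auto

lemma msupp_subset: "msupp K M f \<subseteq> carrier M"
  unfolding msupp_def by auto

lemma A_memI:
  assumes "\<And>x. x \<in> carrier M \<Longrightarrow> f x \<in> carrier K" and "f \<in> extensional (carrier M)"
    and "msupp K M f \<subseteq> B" "finite B"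
  shows "f \<in> carrier A"
  using assms finite_subset unfolding carrier_monoid_algebra PiE_def by auto

lemma A_eqI:
  assumes "f \<in> extensional (carrier M)" "g \<in> extensional (carrier M)"
    and "\<And>x. x \<in> carrier M \<Longrightarrow> f x = g x"
  shows "f = g"
  using assms by (rule extensionalityI)

lemma A_extensional: "f \<in> carrier A \<Longrightarrow> f \<in> extensional (carrier M)"
  unfolding carrier_monoid_algebra PiE_def by auto

text \<open>Terms outside the support vanish. Summing over a larger finite set \<open>B\<close>
  allows elements with different supports to be treated over one common index set.\<close>

lemma linear_extension_superset:
  assumes f: "f \<in> carrier A" and h: "h \<in> carrier M \<rightarrow> carrier K"
    and B: "finite B" "msupp K M f \<subseteq> B" "B \<subseteq> carrier M"
  shows "linear_extension K M h f = (\<Oplus>\<^bsub>K\<^esub>w\<in>B. f w \<otimes>\<^bsub>K\<^esub> h w)"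
  unfolding linear_extension_def
proof (rule K.add.finprod_mono_neutral_cong_left)
  show "f w \<otimes>\<^bsub>K\<^esub> h w = \<zero>\<^bsub>K\<^esub>" if "w \<in> B - msupp K M f" for w
    using that B h by (auto simp: msupp_def Pi_iff)
  show "(\<lambda>w. f w \<otimes>\<^bsub>K\<^esub> h w) \<in> B \<rightarrow> carrier K"
    using B(3) h f by (auto simp: Pi_iff)
qed (use B in auto)

lemma linear_extension_closed [simp]:
  assumes "f \<in> carrier A" "h \<in> carrier M \<rightarrow> carrier K"
  shows "linear_extension K M h f \<in> carrier K"
  unfolding linear_extension_def
  using assms msupp_subset[of f] by (intro K.finsum_closed) (auto simp: Pi_iff)

lemma linear_extension_cong:
  assumes "f \<in> carrier A" "h \<in> carrier M \<rightarrow> carrier K"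
    "\<And>w. w \<in> carrier M \<Longrightarrow> h' w = h w"
  shows "linear_extension K M h' f = linear_extension K M h f"
  unfolding linear_extension_def
  using assms msupp_subset[of f] by (intro K.finsum_cong') (auto simp: Pi_iff)

lemma A_add_closed:
  assumes "f \<in> carrier A" "g \<in> carrier A" shows "f \<oplus>\<^bsub>A\<^esub> g \<in> carrier A"
proof (rule A_memI)
  show "msupp K M (f \<oplus>\<^bsub>A\<^esub> g) \<subseteq> msupp K M f \<union> msupp K M g"
    by (auto simp: msupp_def add_monoid_algebra)
qed (use assms in \<open>auto simp: add_monoid_algebra monoid_algebra_extensional\<close>)

lemma A_smult_closed:
  assumes "c \<in> carrier K" "f \<in> carrier A" shows "c \<odot>\<^bsub>A\<^esub> f \<in> carrier A"
proof (rule A_memI)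
  show "msupp K M (c \<odot>\<^bsub>A\<^esub> f) \<subseteq> msupp K M f"
    using assms by (auto simp: msupp_def smult_monoid_algebra)
qed (use assms in \<open>auto simp: smult_monoid_algebra monoid_algebra_extensional\<close>)

lemma A_zero_closed: "\<zero>\<^bsub>A\<^esub> \<in> carrier A"
proof (rule A_memI)
  show "msupp K M \<zero>\<^bsub>A\<^esub> \<subseteq> {}"
    by (auto simp: msupp_def zero_monoid_algebra)
qed (auto simp: zero_monoid_algebra monoid_algebra_extensional)

lemma basis_elem_closed: "basis_elem K M w \<in> carrier A"
proof (rule A_memI)
  show "msupp K M (basis_elem K M w) \<subseteq> {w}"
    by (auto simp: msupp_def basis_elem_def)
qed (auto simp: basis_elem_def)

lemma linear_extension_add:
  assumes f: "f \<in> carrier A" and g: "g \<in> carrier A" and h: "h \<in> carrier M \<rightarrow> carrier K"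
  shows "linear_extension K M h (f \<oplus>\<^bsub>A\<^esub> g)
    = linear_extension K M h f \<oplus>\<^bsub>K\<^esub> linear_extension K M h g"
proof -
  let ?B = "msupp K M f \<union> msupp K M g"
  have B: "finite ?B" "?B \<subseteq> carrier M" "msupp K M (f \<oplus>\<^bsub>A\<^esub> g) \<subseteq> ?B"
    using finite_msupp[OF f] finite_msupp[OF g] msupp_subset
    by (auto simp: msupp_def add_monoid_algebra)
  have "(\<Oplus>\<^bsub>K\<^esub>w\<in>?B. (f \<oplus>\<^bsub>A\<^esub> g) w \<otimes>\<^bsub>K\<^esub> h w)
      = (\<Oplus>\<^bsub>K\<^esub>w\<in>?B. f w \<otimes>\<^bsub>K\<^esub> h w \<oplus>\<^bsub>K\<^esub> g w \<otimes>\<^bsub>K\<^esub> h w)"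
    using f g h B(2) by (intro K.finsum_cong') (auto simp: add_monoid_algebra K.l_distr Pi_iff subset_iff)
  also have "\<dots> = (\<Oplus>\<^bsub>K\<^esub>w\<in>?B. f w \<otimes>\<^bsub>K\<^esub> h w) \<oplus>\<^bsub>K\<^esub> (\<Oplus>\<^bsub>K\<^esub>w\<in>?B. g w \<otimes>\<^bsub>K\<^esub> h w)"
    using f g h B(2) by (intro K.finsum_addf) (auto simp: Pi_iff subset_iff)
  finally show ?thesis
    using B f g h by (simp add: linear_extension_superset[of _ h ?B] A_add_closed)
qed

lemma linear_extension_smult:
  assumes f: "f \<in> carrier A" and c: "c \<in> carrier K" and h: "h \<in> carrier M \<rightarrow> carrier K"
  shows "linear_extension K M h (c \<odot>\<^bsub>A\<^esub> f) = c \<otimes>\<^bsub>K\<^esub> linear_extension K M h f"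
proof -
  let ?B = "msupp K M f"
  have B: "finite ?B" "?B \<subseteq> carrier M" "msupp K M (c \<odot>\<^bsub>A\<^esub> f) \<subseteq> ?B"
    using finite_msupp[OF f] c msupp_subset by (auto simp: msupp_def smult_monoid_algebra)
  have "(\<Oplus>\<^bsub>K\<^esub>w\<in>?B. (c \<odot>\<^bsub>A\<^esub> f) w \<otimes>\<^bsub>K\<^esub> h w) = (\<Oplus>\<^bsub>K\<^esub>w\<in>?B. c \<otimes>\<^bsub>K\<^esub> (f w \<otimes>\<^bsub>K\<^esub> h w))"
    using f c h B(2) by (intro K.finsum_cong') (auto simp: smult_monoid_algebra K.m_assoc Pi_iff subset_iff)
  also have "\<dots> = c \<otimes>\<^bsub>K\<^esub> (\<Oplus>\<^bsub>K\<^esub>w\<in>?B. f w \<otimes>\<^bsub>K\<^esub> h w)"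
    using f c h B by (intro K.finsum_rdistr[symmetric]) (auto simp: Pi_iff subset_iff)
  finally show ?thesis
    using B f c h by (simp add: linear_extension_superset[of _ h ?B] A_smult_closed)
qed

text \<open>The pairing of a function with an algebra element is additive in the function too. The
  right distributive law needs this: there the sum arises in the inner extension, that is, in the
  function which the outer one extends.\<close>

lemma linear_extension_fun_add:
  assumes f: "f \<in> carrier A" and h: "h \<in> carrier M \<rightarrow> carrier K" "h' \<in> carrier M \<rightarrow> carrier K"
  shows "linear_extension K M (\<lambda>w. h w \<oplus>\<^bsub>K\<^esub> h' w) f
    = linear_extension K M h f \<oplus>\<^bsub>K\<^esub> linear_extension K M h' f"
proof -
  have S: "w \<in> msupp K M f \<Longrightarrow> w \<in> carrier M" for w
    by (simp add: msupp_def)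
  have "linear_extension K M (\<lambda>w. h w \<oplus>\<^bsub>K\<^esub> h' w) f
      = (\<Oplus>\<^bsub>K\<^esub>w\<in>msupp K M f. f w \<otimes>\<^bsub>K\<^esub> h w \<oplus>\<^bsub>K\<^esub> f w \<otimes>\<^bsub>K\<^esub> h' w)"
    unfolding linear_extension_def
    using f h S by (intro K.finsum_cong') (auto simp: K.r_distr Pi_iff)
  also have "\<dots> = linear_extension K M h f \<oplus>\<^bsub>K\<^esub> linear_extension K M h' f"
    unfolding linear_extension_def
    using f h S by (intro K.finsum_addf) (auto simp: Pi_iff)
  finally show ?thesis .
qed

lemma linear_extension_fun_mult:
  assumes f: "f \<in> carrier A" and h: "h \<in> carrier M \<rightarrow> carrier K" and c: "c \<in> carrier K"
  shows "linear_extension K M (\<lambda>w. h w \<otimes>\<^bsub>K\<^esub> c) f = linear_extension K M h f \<otimes>\<^bsub>K\<^esub> c"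
proof -
  have S: "w \<in> msupp K M f \<Longrightarrow> w \<in> carrier M" for w
    by (simp add: msupp_def)
  have "linear_extension K M (\<lambda>w. h w \<otimes>\<^bsub>K\<^esub> c) f
      = (\<Oplus>\<^bsub>K\<^esub>w\<in>msupp K M f. (f w \<otimes>\<^bsub>K\<^esub> h w) \<otimes>\<^bsub>K\<^esub> c)"
    unfolding linear_extension_def
    using f h c S by (intro K.finsum_cong') (auto simp: K.m_assoc Pi_iff)
  also have "\<dots> = linear_extension K M h f \<otimes>\<^bsub>K\<^esub> c"
    unfolding linear_extension_def
    using f h c S by (intro K.finsum_ldistr[symmetric]) (auto simp: Pi_iff)
  finally show ?thesis .
qed

lemma linear_extension_basis:
  assumes w: "w \<in> carrier M" and h: "h \<in> carrier M \<rightarrow> carrier K"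
  shows "linear_extension K M h (basis_elem K M w) = h w"
proof -
  have "linear_extension K M h (basis_elem K M w) = (\<Oplus>\<^bsub>K\<^esub>x\<in>{w}. basis_elem K M w x \<otimes>\<^bsub>K\<^esub> h x)"
    using w h by (intro linear_extension_superset basis_elem_closed)
      (auto simp: msupp_def basis_elem_def)
  also have "\<dots> = h w"
    using w h by (auto simp: basis_elem_def Pi_iff)
  finally show ?thesis .
qed

text \<open>The coordinate functional at \<open>x\<close>, dual to \<open>basis_elem\<close>. It is
  a plain function on the monoid, not an element of the algebra, so it can serve as the function to
  be extended linearly.\<close>

definition delta :: "'m \<Rightarrow> 'm \<Rightarrow> 'k" where
  "delta x w = (if w = x then \<one>\<^bsub>K\<^esub> else \<zero>\<^bsub>K\<^esub>)"

lemma delta_closed [simp]: "delta x \<in> B \<rightarrow> carrier K"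
  by (auto simp: delta_def)

lemma linear_extension_delta:
  assumes f: "f \<in> carrier A" and x: "x \<in> carrier M"
  shows "linear_extension K M (delta x) f = f x"
proof -
  have S: "insert x (msupp K M f) \<subseteq> carrier M"
    using x msupp_subset by auto
  have "linear_extension K M (delta x) f
      = (\<Oplus>\<^bsub>K\<^esub>w\<in>insert x (msupp K M f). f w \<otimes>\<^bsub>K\<^esub> delta x w)"
    using f S by (intro linear_extension_superset) auto
  also have "\<dots> = (\<Oplus>\<^bsub>K\<^esub>w\<in>insert x (msupp K M f). if x = w then f w else \<zero>\<^bsub>K\<^esub>)"
    using f S by (intro K.finsum_cong') (auto simp: delta_def)
  also have "\<dots> = f x"
    using f S by (intro K.finsum_singleton) auto
  finally show ?thesis .
qed

lemma finsum_Times: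
  assumes "finite B" "finite C" "\<And>y z. y \<in> B \<Longrightarrow> z \<in> C \<Longrightarrow> F y z \<in> carrier K"
  shows "(\<Oplus>\<^bsub>K\<^esub>p\<in>B \<times> C. F (fst p) (snd p)) = (\<Oplus>\<^bsub>K\<^esub>y\<in>B. \<Oplus>\<^bsub>K\<^esub>z\<in>C. F y z)"
proof -
  have "B \<times> C = (\<Union>y\<in>B. Pair y ` C)"
    by auto
  also have "(\<Oplus>\<^bsub>K\<^esub>p\<in>(\<Union>y\<in>B. Pair y ` C). F (fst p) (snd p))
      = (\<Oplus>\<^bsub>K\<^esub>y\<in>B. \<Oplus>\<^bsub>K\<^esub>p\<in>Pair y ` C. F (fst p) (snd p))"
    using assms by (intro K.add.finprod_UN_disjoint) (auto simp: pairwise_def disjnt_def)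
  also have "\<dots> = (\<Oplus>\<^bsub>K\<^esub>y\<in>B. \<Oplus>\<^bsub>K\<^esub>z\<in>C. F y z)"
  proof (rule K.finsum_cong')
    show "(\<lambda>y. \<Oplus>\<^bsub>K\<^esub>z\<in>C. F y z) \<in> B \<rightarrow> carrier K"
      using assms by auto
    fix y assume y: "y \<in> B"
    have "(\<Oplus>\<^bsub>K\<^esub>p\<in>Pair y ` C. F (fst p) (snd p)) = (\<Oplus>\<^bsub>K\<^esub>z\<in>C. F (fst (y, z)) (snd (y, z)))"
      using assms y by (intro K.finsum_reindex) (auto simp: inj_on_def)
    then show "(\<Oplus>\<^bsub>K\<^esub>p\<in>Pair y ` C. F (fst p) (snd p)) = (\<Oplus>\<^bsub>K\<^esub>z\<in>C. F y z)"
      by simp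
  qed simp
  finally show ?thesis .
qed

text \<open>A coordinate of the product is an empty sum unless it is a product of two support
  elements, and there are finitely many of those.\<close>

lemma mult_closed_supp:
  assumes f: "f \<in> carrier A" and g: "g \<in> carrier A"
  shows "f \<otimes>\<^bsub>A\<^esub> g \<in> carrier A"
    and "msupp K M (f \<otimes>\<^bsub>A\<^esub> g) \<subseteq> (\<lambda>p. fst p \<otimes>\<^bsub>M\<^esub> snd p) ` (msupp K M f \<times> msupp K M g)"
proof -
  show S: "msupp K M (f \<otimes>\<^bsub>A\<^esub> g) \<subseteq> (\<lambda>p. fst p \<otimes>\<^bsub>M\<^esub> snd p) ` (msupp K M f \<times> msupp K M g)"
  proof
    fix x assume x: "x \<in> msupp K M (f \<otimes>\<^bsub>A\<^esub> g)"
    then have "{p \<in> msupp K M f \<times> msupp K M g. fst p \<otimes>\<^bsub>M\<^esub> snd p = x} \<noteq> {}"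
      by (auto simp: msupp_def mult_monoid_algebra simp del: Collect_empty_eq)
    then show "x \<in> (\<lambda>p. fst p \<otimes>\<^bsub>M\<^esub> snd p) ` (msupp K M f \<times> msupp K M g)"
      by force
  qed
  show "f \<otimes>\<^bsub>A\<^esub> g \<in> carrier A"
  proof (rule A_memI[OF _ _ S])
    fix x assume "x \<in> carrier M"
    then show "(f \<otimes>\<^bsub>A\<^esub> g) x \<in> carrier K"
      using f g by (auto simp: mult_monoid_algebra msupp_def intro!: K.finsum_closed)
  qed (use f g in \<open>auto simp: monoid_algebra_extensional\<close>)
qed

text \<open>The convolution groups the pairs of support elements by their product. The fibres
  \<open>T x\<close> are disjoint and cover \<open>F \<times> G\<close>, so the sum over
  \<open>x\<close> of the sums over fibres is the double sum over both supports. This replaces the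
  definition of the product in everything that follows.\<close>

lemma linear_extension_mult:
  assumes f: "f \<in> carrier A" and g: "g \<in> carrier A" and h: "h \<in> carrier M \<rightarrow> carrier K"
  shows "linear_extension K M h (f \<otimes>\<^bsub>A\<^esub> g)
    = linear_extension K M (\<lambda>y. linear_extension K M (\<lambda>z. h (y \<otimes>\<^bsub>M\<^esub> z)) g) f"
proof -
  define F G where "F = msupp K M f" and "G = msupp K M g"
  define S where "S = (\<lambda>p. fst p \<otimes>\<^bsub>M\<^esub> snd p) ` (F \<times> G)"
  define T where "T x = {p \<in> F \<times> G. fst p \<otimes>\<^bsub>M\<^esub> snd p = x}" for x
  define t where "t p = f (fst p) \<otimes>\<^bsub>K\<^esub> g (snd p) \<otimes>\<^bsub>K\<^esub> h (fst p \<otimes>\<^bsub>M\<^esub> snd p)" for p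
  have fin: "finite F" "finite G" "finite S" "\<And>x. finite (T x)"
    using f g by (auto simp: F_def G_def S_def T_def)
  have sub: "\<And>y. y \<in> F \<Longrightarrow> y \<in> carrier M" "\<And>z. z \<in> G \<Longrightarrow> z \<in> carrier M"
    by (auto simp: F_def G_def msupp_def)
  have subS: "S \<subseteq> carrier M"
    using sub by (auto simp: S_def)
  have hc: "\<And>w. w \<in> carrier M \<Longrightarrow> h w \<in> carrier K"
    using h by auto
  have t: "t \<in> F \<times> G \<rightarrow> carrier K"
    using f g hc sub by (auto simp: t_def)
  have "linear_extension K M h (f \<otimes>\<^bsub>A\<^esub> g) = (\<Oplus>\<^bsub>K\<^esub>x\<in>S. (f \<otimes>\<^bsub>A\<^esub> g) x \<otimes>\<^bsub>K\<^esub> h x)"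
    using mult_closed_supp[OF f g] h fin subS
    by (intro linear_extension_superset) (auto simp: S_def F_def G_def)
  also have "\<dots> = (\<Oplus>\<^bsub>K\<^esub>x\<in>S. \<Oplus>\<^bsub>K\<^esub>p\<in>T x. t p)"
  proof (rule K.finsum_cong')
    show "(\<lambda>x. \<Oplus>\<^bsub>K\<^esub>p\<in>T x. t p) \<in> S \<rightarrow> carrier K"
      using t by (intro funcsetI K.finsum_closed) (auto simp: T_def)
    fix x assume "x \<in> S"
    then have x: "x \<in> carrier M"
      using subS by auto
    have "(f \<otimes>\<^bsub>A\<^esub> g) x \<otimes>\<^bsub>K\<^esub> h x = (\<Oplus>\<^bsub>K\<^esub>p\<in>T x. f (fst p) \<otimes>\<^bsub>K\<^esub> g (snd p)) \<otimes>\<^bsub>K\<^esub> h x"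
      using x by (simp add: mult_monoid_algebra T_def F_def G_def case_prod_unfold)
    also have "\<dots> = (\<Oplus>\<^bsub>K\<^esub>p\<in>T x. f (fst p) \<otimes>\<^bsub>K\<^esub> g (snd p) \<otimes>\<^bsub>K\<^esub> h x)"
      using fin x f g hc sub by (intro K.finsum_ldistr) (auto simp: T_def)
    also have "\<dots> = (\<Oplus>\<^bsub>K\<^esub>p\<in>T x. t p)"
      using t by (intro K.finsum_cong') (fastforce simp: T_def t_def)+
    finally show "(f \<otimes>\<^bsub>A\<^esub> g) x \<otimes>\<^bsub>K\<^esub> h x = (\<Oplus>\<^bsub>K\<^esub>p\<in>T x. t p)" .
  qed simp
  also have "\<dots> = (\<Oplus>\<^bsub>K\<^esub>p\<in>(\<Union>x\<in>S. T x). t p)"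
    using fin t by (intro K.add.finprod_UN_disjoint[symmetric])
      (auto simp: pairwise_def disjnt_def T_def)
  also have "(\<Union>x\<in>S. T x) = F \<times> G"
    by (auto simp: S_def T_def)
  also have "(\<Oplus>\<^bsub>K\<^esub>p\<in>F \<times> G. t p)
      = (\<Oplus>\<^bsub>K\<^esub>y\<in>F. \<Oplus>\<^bsub>K\<^esub>z\<in>G. f y \<otimes>\<^bsub>K\<^esub> g z \<otimes>\<^bsub>K\<^esub> h (y \<otimes>\<^bsub>M\<^esub> z))"
    unfolding t_def using fin f g hc sub by (intro finsum_Times) auto
  also have "\<dots> = (\<Oplus>\<^bsub>K\<^esub>y\<in>F. f y \<otimes>\<^bsub>K\<^esub> linear_extension K M (\<lambda>z. h (y \<otimes>\<^bsub>M\<^esub> z)) g)"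
  proof (rule K.finsum_cong')
    show "(\<lambda>y. f y \<otimes>\<^bsub>K\<^esub> linear_extension K M (\<lambda>z. h (y \<otimes>\<^bsub>M\<^esub> z)) g) \<in> F \<rightarrow> carrier K"
      using f g hc sub by auto
    fix y assume y: "y \<in> F"
    have "(\<Oplus>\<^bsub>K\<^esub>z\<in>G. f y \<otimes>\<^bsub>K\<^esub> g z \<otimes>\<^bsub>K\<^esub> h (y \<otimes>\<^bsub>M\<^esub> z))
        = (\<Oplus>\<^bsub>K\<^esub>z\<in>G. f y \<otimes>\<^bsub>K\<^esub> (g z \<otimes>\<^bsub>K\<^esub> h (y \<otimes>\<^bsub>M\<^esub> z)))"
      using f g hc sub y by (intro K.finsum_cong') (auto simp: K.m_assoc)
    also have "\<dots> = f y \<otimes>\<^bsub>K\<^esub> (\<Oplus>\<^bsub>K\<^esub>z\<in>G. g z \<otimes>\<^bsub>K\<^esub> h (y \<otimes>\<^bsub>M\<^esub> z))"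
      using fin f g hc sub y by (intro K.finsum_rdistr[symmetric]) auto
    finally show "(\<Oplus>\<^bsub>K\<^esub>z\<in>G. f y \<otimes>\<^bsub>K\<^esub> g z \<otimes>\<^bsub>K\<^esub> h (y \<otimes>\<^bsub>M\<^esub> z))
        = f y \<otimes>\<^bsub>K\<^esub> linear_extension K M (\<lambda>z. h (y \<otimes>\<^bsub>M\<^esub> z)) g"
      by (simp add: linear_extension_def G_def)
  qed simp
  finally show ?thesis
    by (simp add: linear_extension_def F_def)
qed

text \<open>Evaluation at \<open>x\<close> is the extension of \<open>delta x\<close>, so the
  previous formula applies to single coordinates.\<close>

lemma mult_apply:
  assumes "f \<in> carrier A" "g \<in> carrier A" "x \<in> carrier M"
  shows "(f \<otimes>\<^bsub>A\<^esub> g) x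
    = linear_extension K M (\<lambda>y. linear_extension K M (\<lambda>z. delta x (y \<otimes>\<^bsub>M\<^esub> z)) g) f"
  using linear_extension_mult[of f g "delta x"] linear_extension_delta[of "f \<otimes>\<^bsub>A\<^esub> g" x]
    mult_closed_supp[of f g] assms by simp

lemma delta_mult_closed [simp]: "(\<lambda>z. delta x (F z)) \<in> B \<rightarrow> carrier K"
  by (auto simp: delta_def)

text \<open>Each coordinate of either side expands into a triple iterated extension of
  \<open>delta x\<close>; the two differ only in the bracketing of \<open>y\<close>,
  \<open>z\<close>, \<open>t\<close> inside the monoid.\<close>

lemma A_mult_assoc:
  assumes f: "f \<in> carrier A" and g: "g \<in> carrier A" and k: "k \<in> carrier A"
  shows "(f \<otimes>\<^bsub>A\<^esub> g) \<otimes>\<^bsub>A\<^esub> k = f \<otimes>\<^bsub>A\<^esub> (g \<otimes>\<^bsub>A\<^esub> k)"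
proof (rule A_eqI)
  fix x assume x: "x \<in> carrier M"
  have inner: "linear_extension K M (\<lambda>t. delta x (F t)) k \<in> carrier K" for F
    using k by simp
  have "((f \<otimes>\<^bsub>A\<^esub> g) \<otimes>\<^bsub>A\<^esub> k) x = linear_extension K M (\<lambda>y. linear_extension K M
      (\<lambda>z. linear_extension K M (\<lambda>t. delta x (y \<otimes>\<^bsub>M\<^esub> z \<otimes>\<^bsub>M\<^esub> t)) k) g) f"
    using f g k x mult_closed_supp[OF f g] inner
    by (simp add: mult_apply linear_extension_mult)
  also have "\<dots> = linear_extension K M (\<lambda>y. linear_extension K M
      (\<lambda>z. linear_extension K M (\<lambda>t. delta x (y \<otimes>\<^bsub>M\<^esub> (z \<otimes>\<^bsub>M\<^esub> t))) k) g) f"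
    using f g k inner by (intro linear_extension_cong) (auto simp: M.m_assoc)
  also have "\<dots> = (f \<otimes>\<^bsub>A\<^esub> (g \<otimes>\<^bsub>A\<^esub> k)) x"
    using f g k x mult_closed_supp[OF g k] inner
    by (simp add: mult_apply linear_extension_mult)
  finally show "((f \<otimes>\<^bsub>A\<^esub> g) \<otimes>\<^bsub>A\<^esub> k) x = (f \<otimes>\<^bsub>A\<^esub> (g \<otimes>\<^bsub>A\<^esub> k)) x" .
qed (simp_all add: monoid_algebra_extensional)

lemma A_one_closed: "\<one>\<^bsub>A\<^esub> \<in> carrier A"
  by (simp add: one_monoid_algebra basis_elem_closed)

lemma A_l_one:
  assumes f: "f \<in> carrier A" shows "\<one>\<^bsub>A\<^esub> \<otimes>\<^bsub>A\<^esub> f = f"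
proof (rule A_eqI)
  fix x assume x: "x \<in> carrier M"
  have "(\<one>\<^bsub>A\<^esub> \<otimes>\<^bsub>A\<^esub> f) x = linear_extension K M (\<lambda>z. delta x (\<one>\<^bsub>M\<^esub> \<otimes>\<^bsub>M\<^esub> z)) f"
    using f x by (simp add: mult_apply one_monoid_algebra basis_elem_closed linear_extension_basis)
  also have "\<dots> = linear_extension K M (delta x) f"
    using f by (intro linear_extension_cong) auto
  finally show "(\<one>\<^bsub>A\<^esub> \<otimes>\<^bsub>A\<^esub> f) x = f x"
    using f x by (simp add: linear_extension_delta)
qed (use f in \<open>simp_all add: monoid_algebra_extensional A_extensional\<close>)

lemma A_r_one:
  assumes f: "f \<in> carrier A" shows "f \<otimes>\<^bsub>A\<^esub> \<one>\<^bsub>A\<^esub> = f"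
proof (rule A_eqI)
  fix x assume x: "x \<in> carrier M"
  have "(f \<otimes>\<^bsub>A\<^esub> \<one>\<^bsub>A\<^esub>) x = linear_extension K M (\<lambda>y. delta x (y \<otimes>\<^bsub>M\<^esub> \<one>\<^bsub>M\<^esub>)) f"
    using f x by (simp add: mult_apply one_monoid_algebra basis_elem_closed linear_extension_basis)
  also have "\<dots> = linear_extension K M (delta x) f"
    using f by (intro linear_extension_cong) auto
  finally show "(f \<otimes>\<^bsub>A\<^esub> \<one>\<^bsub>A\<^esub>) x = f x"
    using f x by (simp add: linear_extension_delta)
qed (use f in \<open>simp_all add: monoid_algebra_extensional A_extensional\<close>)

lemma A_l_distr:
  assumes "f \<in> carrier A" "g \<in> carrier A" "k \<in> carrier A"
  shows "(f \<oplus>\<^bsub>A\<^esub> g) \<otimes>\<^bsub>A\<^esub> k = f \<otimes>\<^bsub>A\<^esub> k \<oplus>\<^bsub>A\<^esub> g \<otimes>\<^bsub>A\<^esub> k"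
proof (rule A_eqI)
  fix x assume "x \<in> carrier M"
  then show "((f \<oplus>\<^bsub>A\<^esub> g) \<otimes>\<^bsub>A\<^esub> k) x = (f \<otimes>\<^bsub>A\<^esub> k \<oplus>\<^bsub>A\<^esub> g \<otimes>\<^bsub>A\<^esub> k) x"
    using assms by (simp add: add_monoid_algebra mult_apply A_add_closed linear_extension_add)
qed (simp_all add: monoid_algebra_extensional)

lemma A_r_distr:
  assumes "f \<in> carrier A" "g \<in> carrier A" "k \<in> carrier A"
  shows "k \<otimes>\<^bsub>A\<^esub> (f \<oplus>\<^bsub>A\<^esub> g) = k \<otimes>\<^bsub>A\<^esub> f \<oplus>\<^bsub>A\<^esub> k \<otimes>\<^bsub>A\<^esub> g"
proof (rule A_eqI)
  fix x assume "x \<in> carrier M"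
  then show "(k \<otimes>\<^bsub>A\<^esub> (f \<oplus>\<^bsub>A\<^esub> g)) x = (k \<otimes>\<^bsub>A\<^esub> f \<oplus>\<^bsub>A\<^esub> k \<otimes>\<^bsub>A\<^esub> g) x"
    using assms
    by (simp add: add_monoid_algebra mult_apply A_add_closed linear_extension_add
        linear_extension_fun_add)
qed (simp_all add: monoid_algebra_extensional)

lemma smult_mult:
  assumes c: "c \<in> carrier K" and f: "f \<in> carrier A" and g: "g \<in> carrier A"
  shows "(c \<odot>\<^bsub>A\<^esub> f) \<otimes>\<^bsub>A\<^esub> g = c \<odot>\<^bsub>A\<^esub> (f \<otimes>\<^bsub>A\<^esub> g)"
proof (rule A_eqI)
  fix x assume "x \<in> carrier M"
  then show "((c \<odot>\<^bsub>A\<^esub> f) \<otimes>\<^bsub>A\<^esub> g) x = (c \<odot>\<^bsub>A\<^esub> (f \<otimes>\<^bsub>A\<^esub> g)) x"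
    using assms
    by (simp add: smult_monoid_algebra mult_apply A_smult_closed linear_extension_smult)
qed (simp_all add: monoid_algebra_extensional)

lemma abelian_group_A: "abelian_group A"
proof (rule abelian_groupI)
  fix f assume f: "f \<in> carrier A"
  \<comment> \<open>The additive inverse is taken as the multiple by -1, whose finite support is
    already known from closure under scalars.\<close>
  have "(\<ominus>\<^bsub>K\<^esub> \<one>\<^bsub>K\<^esub>) \<odot>\<^bsub>A\<^esub> f \<oplus>\<^bsub>A\<^esub> f = \<zero>\<^bsub>A\<^esub>"
  proof (rule A_eqI)
    fix x assume "x \<in> carrier M"
    then show "((\<ominus>\<^bsub>K\<^esub> \<one>\<^bsub>K\<^esub>) \<odot>\<^bsub>A\<^esub> f \<oplus>\<^bsub>A\<^esub> f) x = \<zero>\<^bsub>A\<^esub> x"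
      using f by (simp add: add_monoid_algebra smult_monoid_algebra zero_monoid_algebra
          K.l_minus K.l_neg)
  qed (simp_all add: monoid_algebra_extensional)
  then show "\<exists>g\<in>carrier A. g \<oplus>\<^bsub>A\<^esub> f = \<zero>\<^bsub>A\<^esub>"
    using f by (intro bexI[of _ "(\<ominus>\<^bsub>K\<^esub> \<one>\<^bsub>K\<^esub>) \<odot>\<^bsub>A\<^esub> f"] A_smult_closed) auto
qed (auto intro!: A_add_closed A_zero_closed A_eqI A_extensional
    simp: monoid_algebra_extensional add_monoid_algebra zero_monoid_algebra K.a_ac)

sublocale ring A
  by (intro ringI abelian_group_A monoidI)
    (simp_all add: A_mult_assoc A_l_one A_r_one A_l_distr A_r_distr mult_closed_supp A_one_closed)

sublocale module K A
  by (intro moduleI abelian_group_A K.is_cring)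
    (auto intro!: A_smult_closed A_eqI A_extensional
      simp: monoid_algebra_extensional add_monoid_algebra smult_monoid_algebra
        K.l_distr K.r_distr K.m_assoc)

lemma basis_elem_mult:
  assumes "y \<in> carrier M" "z \<in> carrier M"
  shows "basis_elem K M y \<otimes>\<^bsub>A\<^esub> basis_elem K M z = basis_elem K M (y \<otimes>\<^bsub>M\<^esub> z)"
proof (rule A_eqI)
  fix x assume "x \<in> carrier M"
  then show "(basis_elem K M y \<otimes>\<^bsub>A\<^esub> basis_elem K M z) x = basis_elem K M (y \<otimes>\<^bsub>M\<^esub> z) x"
    using assms by (simp add: mult_apply basis_elem_closed linear_extension_basis delta_def)
      (simp add: basis_elem_def)
qed (simp_all add: monoid_algebra_extensional basis_elem_def)

text \<open>Statements that respect sums need checking only on multiples of basis elements. The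
  induction runs over a finite set containing the support, since inclusion is easier to maintain
  than equality when coordinates are removed.\<close>

lemma monoid_algebra_induct [consumes 1, case_names zero smult add]:
  assumes "f \<in> carrier A" and zero: "P \<zero>\<^bsub>A\<^esub>"
    and smult: "\<And>c w. c \<in> carrier K \<Longrightarrow> w \<in> carrier M \<Longrightarrow> P (c \<odot>\<^bsub>A\<^esub> basis_elem K M w)"
    and add: "\<And>f g. f \<in> carrier A \<Longrightarrow> g \<in> carrier A \<Longrightarrow> P f \<Longrightarrow> P g \<Longrightarrow> P (f \<oplus>\<^bsub>A\<^esub> g)"
  shows "P f"
proof -
  have "finite B \<Longrightarrow> f \<in> carrier A \<Longrightarrow> msupp K M f \<subseteq> B \<Longrightarrow> P f" for B
  proof (induction B arbitrary: f rule: finite_induct)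
    case empty
    have "f = \<zero>\<^bsub>A\<^esub>"
    proof (rule A_eqI)
      fix x assume "x \<in> carrier M"
      then show "f x = \<zero>\<^bsub>A\<^esub> x"
        using empty(2) by (auto simp: zero_monoid_algebra msupp_def)
    qed (use empty(1) in \<open>simp_all add: A_extensional monoid_algebra_extensional\<close>)
    then show ?case
      using zero by simp
  next
    case (insert w B)
    show ?case
    proof (cases "w \<in> carrier M")
      case False
      then have "msupp K M f \<subseteq> B"
        using insert.prems by (auto simp: msupp_def)
      then show ?thesis
        by (rule insert.IH[OF insert.prems(1)])
    next
      case w: True
      \<comment> \<open>\<open>g\<close> is \<open>f\<close> with the coordinate at \<open>w\<close>
        erased; that coordinate is restored by the multiple \<open>f w\<close> of the basis
        element.\<close>
      define g where "g = (\<lambda>x\<in>carrier M. if x = w then \<zero>\<^bsub>K\<^esub> else f x)"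
      have g: "msupp K M g \<subseteq> B"
        using insert.prems by (auto simp: msupp_def g_def)
      have gA: "g \<in> carrier A"
        by (rule A_memI[OF _ _ g insert.hyps(1)]) (use insert.prems(1) in \<open>simp_all add: g_def\<close>)
      have split: "f w \<odot>\<^bsub>A\<^esub> basis_elem K M w \<oplus>\<^bsub>A\<^esub> g = f"
      proof (rule A_eqI)
        fix x assume "x \<in> carrier M"
        then show "(f w \<odot>\<^bsub>A\<^esub> basis_elem K M w \<oplus>\<^bsub>A\<^esub> g) x = f x"
          using insert.prems(1) w
          by (simp add: add_monoid_algebra smult_monoid_algebra basis_elem_def g_def)
      qed (use insert.prems(1) in \<open>simp_all add: A_extensional monoid_algebra_extensional\<close>)
      have "f w \<in> carrier K"
        using insert.prems(1) w by simp
      then have "P (f w \<odot>\<^bsub>A\<^esub> basis_elem K M w \<oplus>\<^bsub>A\<^esub> g)"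
        using insert.IH[OF gA g] gA w by (intro add smult A_smult_closed basis_elem_closed)
      then show ?thesis
        by (simp only: split)
    qed
  qed
  from this[OF finite_msupp[OF assms(1)] assms(1) subset_refl] show ?thesis .
qed

end

section \<open>Monoids given by a presentation\<close>

lemma presented_cong_lists:
  assumes "(u, v) \<in> presented_cong S R"
  shows "u \<in> lists S \<and> v \<in> lists S"
  using assms by induction auto

lemma equiv_presented_cong: "equiv (lists S) (presented_cong S R)"
proof (rule equivI)
  show "presented_cong S R \<subseteq> lists S \<times> lists S"
    by (intro subrelI SigmaI presented_cong_lists[THEN conjunct1] presented_cong_lists[THEN conjunct2])
  show "refl_on (lists S) (presented_cong S R)"
    by (intro refl_onI presented_cong.refl)
  show "sym (presented_cong S R)"
    by (blast intro: symI presented_cong.sym)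
  show "trans (presented_cong S R)"
    by (blast intro: transI presented_cong.trans)
qed

text \<open>The congruence is compatible with concatenation, so all classes in the union that
  defines the product coincide.\<close>

lemma presented_monoid_mult:
  assumes "u \<in> lists S" "v \<in> lists S"
  shows "presented_cong S R `` {u} \<otimes>\<^bsub>presented_monoid S R\<^esub> presented_cong S R `` {v}
    = presented_cong S R `` {u @ v}"
proof -
  have "congruent2 (presented_cong S R) (presented_cong S R)
      (\<lambda>u v. presented_cong S R `` {u @ v})"
    by (auto simp: congruent2_def intro!: equiv_class_eq[OF equiv_presented_cong] presented_cong.append)
  then show ?thesis
    using assms UN_equiv_class2[OF equiv_presented_cong equiv_presented_cong]
    by (simp add: presented_monoid_def)
qed

lemma presented_monoid_carrier_iff:
  "w \<in> carrier (presented_monoid S R) \<longleftrightarrow> (\<exists>u\<in>lists S. w = presented_cong S R `` {u})"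
  by (auto simp: presented_monoid_def quotient_def)

lemma presented_monoid_one: "\<one>\<^bsub>presented_monoid S R\<^esub> = presented_cong S R `` {[]}"
  by (simp add: presented_monoid_def)

lemma monoid_presented_monoid: "Group.monoid (presented_monoid S R)"
proof -
  note D = presented_monoid_carrier_iff[THEN iffD1]
  show ?thesis
  proof (rule monoidI)
    fix x y assume "x \<in> carrier (presented_monoid S R)" "y \<in> carrier (presented_monoid S R)"
    then obtain u v where uv: "u \<in> lists S" "v \<in> lists S"
      and x: "x = presented_cong S R `` {u}" "y = presented_cong S R `` {v}"
      by (blast dest: D)
    show "x \<otimes>\<^bsub>presented_monoid S R\<^esub> y \<in> carrier (presented_monoid S R)"
      unfolding x presented_monoid_mult[OF uv] presented_monoid_carrier_iff
      using uv by (intro bexI[of _ "u @ v"]) simp_all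
    fix z assume "z \<in> carrier (presented_monoid S R)"
    then obtain w where w: "w \<in> lists S" and z: "z = presented_cong S R `` {w}"
      by (blast dest: D)
    have "u @ v \<in> lists S" "v @ w \<in> lists S"
      using uv w by simp_all
    then show "x \<otimes>\<^bsub>presented_monoid S R\<^esub> y \<otimes>\<^bsub>presented_monoid S R\<^esub> z
        = x \<otimes>\<^bsub>presented_monoid S R\<^esub> (y \<otimes>\<^bsub>presented_monoid S R\<^esub> z)"
      unfolding x z using uv w by (simp only: presented_monoid_mult append_assoc)
  next
    have nil: "[] \<in> lists S"
      by simp
    show "\<one>\<^bsub>presented_monoid S R\<^esub> \<in> carrier (presented_monoid S R)"
      unfolding presented_monoid_one presented_monoid_carrier_iff using nil by blast
    fix x assume "x \<in> carrier (presented_monoid S R)"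
    then obtain u where u: "u \<in> lists S" and x: "x = presented_cong S R `` {u}"
      by (blast dest: D)
    show "\<one>\<^bsub>presented_monoid S R\<^esub> \<otimes>\<^bsub>presented_monoid S R\<^esub> x = x"
      "x \<otimes>\<^bsub>presented_monoid S R\<^esub> \<one>\<^bsub>presented_monoid S R\<^esub> = x"
      unfolding x presented_monoid_one using u nil by (simp_all only: presented_monoid_mult append_Nil append_Nil2)
  qed
qed

section \<open>Kiselman's semigroup and the content of its elements\<close>

definition word_class :: "nat \<Rightarrow> nat list \<Rightarrow> nat list set" where
  "word_class n u = presented_cong {1..n} (kiselman_rels n) `` {u}"

lemma kiselman_carrier_iff:
  "w \<in> carrier (kiselman n) \<longleftrightarrow> (\<exists>u\<in>lists {1..n}. w = word_class n u)"
  unfolding kiselman_def word_class_def by (rule presented_monoid_carrier_iff)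

lemma word_class_closed: "u \<in> lists {1..n} \<Longrightarrow> word_class n u \<in> carrier (kiselman n)"
  unfolding kiselman_carrier_iff by blast

lemma kiselman_mult:
  "u \<in> lists {1..n} \<Longrightarrow> v \<in> lists {1..n}
    \<Longrightarrow> word_class n u \<otimes>\<^bsub>kiselman n\<^esub> word_class n v = word_class n (u @ v)"
  unfolding kiselman_def word_class_def by (rule presented_monoid_mult)

lemma kiselman_one: "\<one>\<^bsub>kiselman n\<^esub> = word_class n []"
  unfolding kiselman_def word_class_def by (rule presented_monoid_one)

lemma monoid_kiselman: "Group.monoid (kiselman n)"
  unfolding kiselman_def by (rule monoid_presented_monoid)

lemma word_class_rel:
  assumes "(u, v) \<in> kiselman_rels n"
  shows "word_class n u = word_class n v"
proof -
  have "u \<in> lists {1..n}" "v \<in> lists {1..n}"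
    using assms by (auto simp: kiselman_rels_def)
  then show ?thesis
    unfolding word_class_def using assms
    by (intro equiv_class_eq[OF equiv_presented_cong] presented_cong.base)
qed

text \<open>In every relation both sides use the same letters, and this survives concatenation and
  the equivalence closure. Hence the content can be read off from any single representing
  word.\<close>

lemma presented_cong_set:
  assumes "(u, v) \<in> presented_cong S (kiselman_rels n)"
  shows "set u = set v"
  using assms
proof induction
  case (base u v)
  then show ?case
    by (auto simp: kiselman_rels_def)
qed simp_all

lemma content_word_class:
  assumes u: "u \<in> lists {1..n}"
  shows "content n (word_class n u) = set u"
proof -
  have "u \<in> word_class n u"
    unfolding word_class_def using presented_cong.refl[OF u] by simp
  moreover have "set v = set u" if "v \<in> word_class n u" for v
    using that presented_cong_set[of u v] unfolding word_class_def by simp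
  moreover have "set u \<subseteq> {1..n}"
    using u by auto
  ultimately show ?thesis
    unfolding content_def by blast
qed

lemma content_one: "content n \<one>\<^bsub>kiselman n\<^esub> = {}"
  by (simp add: kiselman_one content_word_class)

lemma content_mult:
  assumes "x \<in> carrier (kiselman n)" "y \<in> carrier (kiselman n)"
  shows "content n (x \<otimes>\<^bsub>kiselman n\<^esub> y) = content n x \<union> content n y"
proof -
  obtain u where u: "u \<in> lists {1..n}" "x = word_class n u"
    using assms(1) unfolding kiselman_carrier_iff by blast
  obtain v where v: "v \<in> lists {1..n}" "y = word_class n v"
    using assms(2) unfolding kiselman_carrier_iff by blast
  have "u @ v \<in> lists {1..n}"
    using u v by simp
  then show ?thesis
    by (simp only: u(2) v(2) kiselman_mult[OF u(1) v(1)] content_word_class[OF u(1)]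
        content_word_class[OF v(1)] content_word_class set_append)
qed

lemma kiselman_zero_word_class: "kiselman_zero n = word_class n (rev [1..<Suc n])"
  by (simp add: kiselman_zero_def word_class_def)

lemma kiselman_zero_closed: "kiselman_zero n \<in> carrier (kiselman n)"
  unfolding kiselman_zero_word_class by (rule word_class_closed) auto

lemma content_kiselman_zero: "content n (kiselman_zero n) = {1..n}"
  unfolding kiselman_zero_word_class by (subst content_word_class) auto

section \<open>Equivalence of representations and transport to another type\<close>

lemma self_module_simps [simp]:
  "carrier (self_module K) = carrier K" "add (self_module K) = add K"
  "zero (self_module K) = zero K" "smult (self_module K) = mult K"
  by (simp_all add: self_module_def)

lemma module_self_module:
  assumes "field K"
  shows "module K (self_module K)"
proof -
  interpret field K by fact
  show ?thesis
  proof (intro moduleI is_cring abelian_groupI)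
    fix x assume "x \<in> carrier (self_module K)"
    then show "\<exists>y\<in>carrier (self_module K). y \<oplus>\<^bsub>self_module K\<^esub> x = \<zero>\<^bsub>self_module K\<^esub>"
      unfolding self_module_simps by (intro bexI[of _ "\<ominus>\<^bsub>K\<^esub> x"]) (simp_all add: l_neg)
  qed (simp_all add: a_ac l_distr r_distr m_assoc)
qed

lemma rep_equivalent_refl: "rep_equivalent K A V \<phi> V \<phi>"
  unfolding rep_equivalent_def by (intro exI[of _ "\<lambda>v. v"]) (auto simp: bij_betw_def)

lemma rep_equivalent_trans:
  assumes VW: "rep_equivalent K A V \<phi> W \<psi>" and WU: "rep_equivalent K A W \<psi> U \<chi>"
  shows "rep_equivalent K A V \<phi> U \<chi>"
proof -
  obtain T where T: "bij_betw T (carrier V) (carrier W)"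
    "\<And>v v'. v \<in> carrier V \<Longrightarrow> v' \<in> carrier V \<Longrightarrow> T (v \<oplus>\<^bsub>V\<^esub> v') = T v \<oplus>\<^bsub>W\<^esub> T v'"
    "\<And>c v. c \<in> carrier K \<Longrightarrow> v \<in> carrier V \<Longrightarrow> T (c \<odot>\<^bsub>V\<^esub> v) = c \<odot>\<^bsub>W\<^esub> T v"
    "\<And>a v. a \<in> carrier A \<Longrightarrow> v \<in> carrier V \<Longrightarrow> T (\<phi> a v) = \<psi> a (T v)"
    using VW unfolding rep_equivalent_def by blast
  obtain T' where T': "bij_betw T' (carrier W) (carrier U)"
    "\<And>v v'. v \<in> carrier W \<Longrightarrow> v' \<in> carrier W \<Longrightarrow> T' (v \<oplus>\<^bsub>W\<^esub> v') = T' v \<oplus>\<^bsub>U\<^esub> T' v'"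
    "\<And>c v. c \<in> carrier K \<Longrightarrow> v \<in> carrier W \<Longrightarrow> T' (c \<odot>\<^bsub>W\<^esub> v) = c \<odot>\<^bsub>U\<^esub> T' v"
    "\<And>a v. a \<in> carrier A \<Longrightarrow> v \<in> carrier W \<Longrightarrow> T' (\<psi> a v) = \<chi> a (T' v)"
    using WU unfolding rep_equivalent_def by blast
  have W: "v \<in> carrier V \<Longrightarrow> T v \<in> carrier W" for v
    using T(1) bij_betwE by blast
  show ?thesis
    unfolding rep_equivalent_def
    by (intro exI[of _ "T' \<circ> T"] conjI bij_betw_trans[OF T(1) T'(1)])
      (simp_all add: T(2-4) T'(2-4) W)
qed

text \<open>The inverse of an intertwiner is again one. Equivalence by itself does not say that the
  operations and the action stay inside \<open>V\<close>; the hypothesis on \<open>V\<close>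
  supplies this, so that the inverse can be cancelled on their results.\<close>

lemma rep_equivalent_sym:
  assumes V: "representation K A V \<phi>" and VW: "rep_equivalent K A V \<phi> W \<psi>"
  shows "rep_equivalent K A W \<psi> V \<phi>"
proof -
  interpret V: representation K A V \<phi> by fact
  obtain T where T: "bij_betw T (carrier V) (carrier W)"
    "\<And>v v'. v \<in> carrier V \<Longrightarrow> v' \<in> carrier V \<Longrightarrow> T (v \<oplus>\<^bsub>V\<^esub> v') = T v \<oplus>\<^bsub>W\<^esub> T v'"
    "\<And>c v. c \<in> carrier K \<Longrightarrow> v \<in> carrier V \<Longrightarrow> T (c \<odot>\<^bsub>V\<^esub> v) = c \<odot>\<^bsub>W\<^esub> T v"
    "\<And>a v. a \<in> carrier A \<Longrightarrow> v \<in> carrier V \<Longrightarrow> T (\<phi> a v) = \<psi> a (T v)"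
    using VW unfolding rep_equivalent_def by blast
  define T' where "T' = the_inv_into (carrier V) T"
  have inv: "T' (T v) = v" if "v \<in> carrier V" for v
    unfolding T'_def using that T(1) by (auto simp: bij_betw_def the_inv_into_f_f)
  have im: "\<exists>v\<in>carrier V. w = T v" if "w \<in> carrier W" for w
    using that T(1) by (auto simp: bij_betw_def)
  show ?thesis
    unfolding rep_equivalent_def
  proof (intro exI[of _ T'] conjI ballI)
    show "bij_betw T' (carrier W) (carrier V)"
      unfolding T'_def by (rule bij_betw_the_inv_into[OF T(1)])
    fix w assume w: "w \<in> carrier W"
    obtain v where v: "v \<in> carrier V" "w = T v"
      by (rule bexE[OF im[OF w]])
    show "T' (w \<oplus>\<^bsub>W\<^esub> w') = T' w \<oplus>\<^bsub>V\<^esub> T' w'" if w': "w' \<in> carrier W" for w'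
    proof -
      obtain v' where v': "v' \<in> carrier V" "w' = T v'"
        by (rule bexE[OF im[OF w']])
      have "T' (T (v \<oplus>\<^bsub>V\<^esub> v')) = T' (T v) \<oplus>\<^bsub>V\<^esub> T' (T v')"
        by (simp only: inv[OF v(1)] inv[OF v'(1)] inv[OF V.M.a_closed[OF v(1) v'(1)]])
      then show ?thesis
        by (simp only: v(2) v'(2) T(2)[OF v(1) v'(1)])
    qed
    show "T' (c \<odot>\<^bsub>W\<^esub> w) = c \<odot>\<^bsub>V\<^esub> T' w" if "c \<in> carrier K" for c
    proof -
      have "T' (T (c \<odot>\<^bsub>V\<^esub> v)) = c \<odot>\<^bsub>V\<^esub> T' (T v)"
        by (simp only: inv[OF v(1)] inv[OF V.smult_closed[OF that v(1)]])
      then show ?thesis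
        by (simp only: v(2) T(3)[OF that v(1)])
    qed
    show "T' (\<psi> a w) = \<phi> a (T' w)" if "a \<in> carrier A" for a
    proof -
      have "T' (T (\<phi> a v)) = \<phi> a (T' (T v))"
        by (simp only: inv[OF v(1)] inv[OF V.act_closed[OF that v(1)]])
      then show ?thesis
        by (simp only: v(2) T(4)[OF that v(1)])
    qed
  qed
qed

text \<open>A copy of \<open>V\<close> on the image of \<open>T\<close>, with all operations carried
  over through the inverse of \<open>T\<close>. It moves a space into a prescribed type.\<close>

definition transport_module ::
  "('k, 'v, 'e) module_scheme \<Rightarrow> ('v \<Rightarrow> 'w) \<Rightarrow> ('k, 'w) module" where
  "transport_module V T = (let T' = the_inv_into (carrier V) T in
    \<lparr>carrier = T ` carrier V, mult = undefined, one = undefined, zero = T \<zero>\<^bsub>V\<^esub>,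
     add = (\<lambda>x y. T (T' x \<oplus>\<^bsub>V\<^esub> T' y)), smult = (\<lambda>c x. T (c \<odot>\<^bsub>V\<^esub> T' x))\<rparr>)"

text \<open>\<open>T\<close> is an intertwiner by construction, so the axioms for the copy reduce to
  those for \<open>V\<close>, and an invariant subspace of the copy is the image of an invariant
  subspace of \<open>V\<close>.\<close>

lemma irreducible_representation_transport:
  fixes V :: "('k, 'v, 'e) module_scheme" and T :: "'v \<Rightarrow> 'w"
  assumes irr: "irreducible_representation K A V \<phi>" and inj: "inj_on T (carrier V)"
  defines "W \<equiv> transport_module V T"
    and "\<psi> \<equiv> \<lambda>a w. T (\<phi> a (the_inv_into (carrier V) T w))"
  shows "irreducible_representation K A W \<psi>" and "rep_equivalent K A V \<phi> W \<psi>"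
proof -
  interpret V: irreducible_representation K A V \<phi> by fact
  define T' where "T' = the_inv_into (carrier V) T"
  have inv [simp]: "T' (T v) = v" if "v \<in> carrier V" for v
    unfolding T'_def by (rule the_inv_into_f_f[OF inj that])
  have W [simp]: "carrier W = T ` carrier V" "\<zero>\<^bsub>W\<^esub> = T \<zero>\<^bsub>V\<^esub>"
    "x \<oplus>\<^bsub>W\<^esub> y = T (T' x \<oplus>\<^bsub>V\<^esub> T' y)" "c \<odot>\<^bsub>W\<^esub> x = T (c \<odot>\<^bsub>V\<^esub> T' x)" for x y c
    by (simp_all add: W_def transport_module_def Let_def T'_def)
  have psi [simp]: "\<psi> a w = T (\<phi> a (T' w))" for a w
    by (simp add: \<psi>_def T'_def)
  have agW: "abelian_group W"
  proof (rule abelian_groupI)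
    fix x assume "x \<in> carrier W"
    then show "\<exists>y\<in>carrier W. y \<oplus>\<^bsub>W\<^esub> x = \<zero>\<^bsub>W\<^esub>"
      by (auto intro!: bexI[of _ "\<ominus>\<^bsub>V\<^esub> T' x"] simp: V.M.l_neg)
  qed (auto simp: V.M.a_ac)
  have mW: "module K W"
    by (intro moduleI V.is_cring agW)
      (auto simp: V.smult_l_distr V.smult_r_distr V.smult_assoc1)
  have rW: "representation K A W \<psi>"
  proof (intro representation.intro V.field_axioms mW representation_axioms.intro)
  qed (auto simp: V.act_closed V.act_add V.act_smult V.add_act V.smult_act V.mult_act V.one_act)
  show eq: "rep_equivalent K A V \<phi> W \<psi>"
    unfolding rep_equivalent_def using inj
    by (intro exI[of _ T]) (auto simp: bij_betw_def)
  show "irreducible_representation K A W \<psi>"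
  proof (intro irreducible_representation.intro rW irreducible_representation_axioms.intro)
    show "carrier W \<noteq> {\<zero>\<^bsub>W\<^esub>}"
    proof
      assume "carrier W = {\<zero>\<^bsub>W\<^esub>}"
      then have "T ` carrier V = T ` {\<zero>\<^bsub>V\<^esub>}"
        by simp
      then have "carrier V = {\<zero>\<^bsub>V\<^esub>}"
        using inj by (subst (asm) inj_on_image_eq_iff[OF inj]) auto
      then show False
        using V.nonzero by simp
    qed
    fix U assume U: "submodule U K W" and stable: "\<And>a w. a \<in> carrier A \<Longrightarrow> w \<in> U \<Longrightarrow> \<psi> a w \<in> U"
    define U' where "U' = {v \<in> carrier V. T v \<in> U}"
    note UE = module.submoduleE[OF mW U]
    have TU: "U = T ` U'"
      using UE(1) by (auto simp: U'_def)
    have add: "T (v \<oplus>\<^bsub>V\<^esub> v') \<in> U" if "v \<in> U'" "v' \<in> U'" for v v'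
      using UE(5)[of "T v" "T v'"] that by (auto simp: U'_def)
    have smult: "T (c \<odot>\<^bsub>V\<^esub> v) \<in> U" if "c \<in> carrier K" "v \<in> U'" for c v
      using UE(4)[of c "T v"] that by (auto simp: U'_def)
    \<comment> \<open>A submodule is nonempty, and multiplying any of its vectors by the scalar 0
      yields the zero vector; negatives below arise likewise from the scalar -1.\<close>
    have zero: "\<zero>\<^bsub>V\<^esub> \<in> U'"
    proof -
      obtain v where "v \<in> U'"
        using UE(2) TU by auto
      then show ?thesis
        using smult[of "\<zero>\<^bsub>K\<^esub>" v] by (auto simp: U'_def)
    qed
    have "submodule U' K V"
    proof (rule V.submoduleI)
      fix v assume v: "v \<in> U'"
      then show "\<ominus>\<^bsub>V\<^esub> v \<in> U'"
        using smult[of "\<ominus>\<^bsub>K\<^esub> \<one>\<^bsub>K\<^esub>" v] by (auto simp: U'_def V.smult_l_minus)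
    qed (use zero add smult in \<open>auto simp: U'_def\<close>)
    moreover have "\<phi> a v \<in> U'" if "a \<in> carrier A" "v \<in> U'" for a v
      using stable[of a "T v"] that by (auto simp: U'_def V.act_closed)
    ultimately have "U' = {\<zero>\<^bsub>V\<^esub>} \<or> U' = carrier V"
      by (rule V.no_invariant_subspace)
    then show "U = {\<zero>\<^bsub>W\<^esub>} \<or> U = carrier W"
      using TU by auto
  qed
qed

section \<open>Counting classes of irreducible representations\<close>

text \<open>A complete and irredundant list indexed by \<open>J\<close> gives a bijection from
  \<open>J\<close> to the classes. The listed representations live on \<open>W\<close> in the type
  \<open>'w\<close>, while the classes contain spaces over \<open>'v\<close>; the copies
  \<open>m j\<close> in \<open>'v\<close> serve as representatives, and \<open>small\<close>
  provides the injection that makes them.\<close>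

lemma card_irrep_classes:
  fixes W :: "('k, 'w) module" and r :: "'j \<Rightarrow> 'a \<Rightarrow> 'w \<Rightarrow> 'w"
  assumes irr: "\<And>j. j \<in> J \<Longrightarrow> irreducible_representation K A W (r j)"
    and ineq: "\<And>i j. i \<in> J \<Longrightarrow> j \<in> J \<Longrightarrow> i \<noteq> j \<Longrightarrow> \<not> rep_equivalent K A W (r i) W (r j)"
    and exh: "\<And>(V :: ('k, 'v) module) \<phi>. irreducible_representation K A V \<phi>
      \<Longrightarrow> \<exists>j\<in>J. rep_equivalent K A V \<phi> W (r j)"
    and small: "carrier W \<lesssim> (UNIV :: 'v set)"
  shows "card (irrep_classes K A TYPE('v)) = card J"
proof -
  obtain T :: "'w \<Rightarrow> 'v" where T: "inj_on T (carrier W)"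
    using small unfolding lepoll_def by auto
  define I where "I = {(V :: ('k, 'v) module, \<phi>). irreducible_representation K A V \<phi>}"
  define E where "E = {((V :: ('k, 'v) module, \<phi>), (V' :: ('k, 'v) module, \<psi>)).
    irreducible_representation K A V \<phi> \<and> irreducible_representation K A V' \<psi>
      \<and> rep_equivalent K A V \<phi> V' \<psi>}"
  have classes: "irrep_classes K A TYPE('v) = I // E"
    by (simp add: irrep_classes_def I_def E_def)
  have rep: "irreducible_representation K A V \<phi> \<Longrightarrow> representation K A V \<phi>"
    for V :: "('k, 'x) module" and \<phi>
    by (rule irreducible_representation.axioms(1))
  have eqE: "equiv I E"
  proof (rule equivI)
    show "sym E"
      by (auto simp: E_def intro!: symI intro: rep_equivalent_sym rep)
    show "trans E"
      by (auto simp: E_def intro!: transI intro: rep_equivalent_trans)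
  qed (auto simp: E_def I_def refl_on_def rep_equivalent_refl)
  define m where "m j = (transport_module W T, \<lambda>a w. T (r j a (the_inv_into (carrier W) T w)))" for j
  have mI: "m j \<in> I" and mE: "rep_equivalent K A W (r j) (fst (m j)) (snd (m j))" if "j \<in> J" for j
    using irreducible_representation_transport[OF irr[OF that] T] by (auto simp: m_def I_def)
  have irrm: "irreducible_representation K A (fst (m j)) (snd (m j))" if "j \<in> J" for j
    using mI[OF that] by (auto simp: I_def)
  have "bij_betw (\<lambda>j. E `` {m j}) J (I // E)"
    unfolding bij_betw_def
  proof
    show "inj_on (\<lambda>j. E `` {m j}) J"
    proof (rule inj_onI, rule ccontr)
      fix i j assume ij: "i \<in> J" "j \<in> J" "E `` {m i} = E `` {m j}" "i \<noteq> j"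
      then have "(m i, m j) \<in> E"
        using eq_equiv_class_iff[OF eqE] mI by metis
      then have "rep_equivalent K A (fst (m i)) (snd (m i)) (fst (m j)) (snd (m j))"
        by (auto simp: E_def)
      \<comment> \<open>Chain through the copies: \<open>r i\<close>, \<open>m i\<close>,
        \<open>m j\<close>, \<open>r j\<close>.\<close>
      then have "rep_equivalent K A W (r i) W (r j)"
        by (metis ij(1,2) mE irr rep rep_equivalent_sym rep_equivalent_trans)
      then show False
        using ineq ij by blast
    qed
    show "(\<lambda>j. E `` {m j}) ` J = I // E"
    proof
      show "(\<lambda>j. E `` {m j}) ` J \<subseteq> I // E"
        using mI by (auto intro: quotientI)
      show "I // E \<subseteq> (\<lambda>j. E `` {m j}) ` J"
      proof
        fix C assume "C \<in> I // E"
        then obtain V \<phi> where V: "irreducible_representation K A V \<phi>" and C: "C = E `` {(V, \<phi>)}"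
          by (auto simp: quotient_def I_def)
        obtain j where j: "j \<in> J" "rep_equivalent K A V \<phi> W (r j)"
          using exh[OF V] by blast
        then have "rep_equivalent K A V \<phi> (fst (m j)) (snd (m j))"
          using mE rep_equivalent_trans by metis
        then have "((V, \<phi>), m j) \<in> E"
          using V irrm[OF j(1)] by (auto simp: E_def case_prod_unfold)
        then have "C = E `` {m j}"
          unfolding C by (rule equiv_class_eq[OF eqE])
        then show "C \<in> (\<lambda>j. E `` {m j}) ` J"
          using j(1) by blast
      qed
    qed
  qed
  then show ?thesis
    unfolding classes by (rule bij_betw_same_card[symmetric])
qed

section \<open>Representations of a quotient algebra\<close>

text \<open>The action induced on cosets, through an arbitrarily chosen representative. The choice
  becomes immaterial once the ideal is known to act as zero.\<close>

definition quotient_act :: "('a \<Rightarrow> 'v \<Rightarrow> 'v) \<Rightarrow> 'a set \<Rightarrow> 'v \<Rightarrow> 'v" where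
  "quotient_act \<phi> C v = \<phi> (SOME a. a \<in> C) v"

text \<open>For scalars to act on cosets the ideal must also be a subspace. The locale does not
  relate scalar multiplication to the product of \<open>A\<close>, so this is assumed here and
  established separately for the concrete ideal.\<close>

locale algebra_ideal = K?: field K + A?: module K A + ideal I A
  for K :: "('k, 'c) ring_scheme" and A :: "('k, 'a, 'd) module_scheme" and I :: "'a set" +
  assumes smult_ideal: "c \<in> carrier K \<Longrightarrow> a \<in> I \<Longrightarrow> c \<odot>\<^bsub>A\<^esub> a \<in> I"
begin

abbreviation Q where "Q \<equiv> quotient_algebra A I"

lemma quotient_algebra_sel:
  "carrier Q = a_rcosets\<^bsub>A\<^esub> I" "C \<otimes>\<^bsub>Q\<^esub> D = rcoset_mult A I C D"
  "\<one>\<^bsub>Q\<^esub> = I +>\<^bsub>A\<^esub> \<one>\<^bsub>A\<^esub>" "C \<oplus>\<^bsub>Q\<^esub> D = C <+>\<^bsub>A\<^esub> D"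
  "c \<odot>\<^bsub>Q\<^esub> C = (\<Union>a\<in>C. I +>\<^bsub>A\<^esub> (c \<odot>\<^bsub>A\<^esub> a))"
  by (simp_all add: quotient_algebra_def FactRing_def ring.defs module.defs)

lemma coset_cases:
  assumes "C \<in> carrier Q"
  obtains a where "a \<in> carrier A" "C = I +>\<^bsub>A\<^esub> a"
  using assms unfolding quotient_algebra_sel A_RCOSETS_def' a_r_coset_def' by blast

lemma coset_closed: "a \<in> carrier A \<Longrightarrow> I +>\<^bsub>A\<^esub> a \<in> carrier Q"
  unfolding quotient_algebra_sel A_RCOSETS_def' a_r_coset_def' by blast

lemma coset_memE:
  assumes "b \<in> I +>\<^bsub>A\<^esub> a"
  obtains i where "i \<in> I" "b = i \<oplus>\<^bsub>A\<^esub> a"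
  using assms unfolding a_r_coset_def' by blast

lemma coset_eqI:
  assumes "a \<in> carrier A" "i \<in> I"
  shows "I +>\<^bsub>A\<^esub> (i \<oplus>\<^bsub>A\<^esub> a) = I +>\<^bsub>A\<^esub> a"
proof -
  have "I +>\<^bsub>A\<^esub> a = I +>\<^bsub>A\<^esub> (i \<oplus>\<^bsub>A\<^esub> a)"
    by (rule a_repr_independence[OF _ assms(1) a_subgroup])
      (use assms(2) in \<open>auto simp: a_r_coset_def'\<close>)
  then show ?thesis
    by (rule HOL.sym)
qed

lemma coset_self: "a \<in> carrier A \<Longrightarrow> a \<in> I +>\<^bsub>A\<^esub> a"
  by (force simp: a_r_coset_def' intro: bexI[of _ "\<zero>\<^bsub>A\<^esub>"])

lemma coset_add:
  "a \<in> carrier A \<Longrightarrow> b \<in> carrier A \<Longrightarrow> (I +>\<^bsub>A\<^esub> a) \<oplus>\<^bsub>Q\<^esub> (I +>\<^bsub>A\<^esub> b) = I +>\<^bsub>A\<^esub> (a \<oplus>\<^bsub>A\<^esub> b)"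
  by (simp add: quotient_algebra_sel a_rcos_sum)

lemma coset_mult:
  "a \<in> carrier A \<Longrightarrow> b \<in> carrier A \<Longrightarrow> (I +>\<^bsub>A\<^esub> a) \<otimes>\<^bsub>Q\<^esub> (I +>\<^bsub>A\<^esub> b) = I +>\<^bsub>A\<^esub> (a \<otimes>\<^bsub>A\<^esub> b)"
  by (simp add: quotient_algebra_sel rcoset_mult_add)

text \<open>Representatives of one coset differ by some \<open>i\<close> in the ideal, and their
  multiples by \<open>c \<odot> i\<close>, again in the ideal. So the union that defines the scalar
  action is a single coset.\<close>

lemma coset_smult:
  assumes c: "c \<in> carrier K" and a: "a \<in> carrier A"
  shows "c \<odot>\<^bsub>Q\<^esub> (I +>\<^bsub>A\<^esub> a) = I +>\<^bsub>A\<^esub> (c \<odot>\<^bsub>A\<^esub> a)"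
proof -
  have "I +>\<^bsub>A\<^esub> (c \<odot>\<^bsub>A\<^esub> b) = I +>\<^bsub>A\<^esub> (c \<odot>\<^bsub>A\<^esub> a)" if b: "b \<in> I +>\<^bsub>A\<^esub> a" for b
  proof -
    obtain i where i: "i \<in> I" "b = i \<oplus>\<^bsub>A\<^esub> a"
      using coset_memE[OF b] by blast
    have "c \<odot>\<^bsub>A\<^esub> b = c \<odot>\<^bsub>A\<^esub> i \<oplus>\<^bsub>A\<^esub> c \<odot>\<^bsub>A\<^esub> a"
      using c a i by (simp add: smult_r_distr Icarr)
    then show ?thesis
      using c a i by (simp add: coset_eqI smult_ideal)
  qed
  then show ?thesis
    unfolding quotient_algebra_sel using coset_self[OF a] by blast
qed

lemma representation_pullback:
  assumes "representation K Q V \<psi>"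
  shows "representation K A V (\<lambda>a. \<psi> (I +>\<^bsub>A\<^esub> a))"
proof -
  interpret V: representation K Q V \<psi> by fact
  show ?thesis
  proof (intro representation.intro representation_axioms.intro K.field_axioms representation.axioms(2)[OF assms])
    show "\<psi> (I +>\<^bsub>A\<^esub> \<one>\<^bsub>A\<^esub>) v = v" if "v \<in> carrier V" for v
      using V.one_act[OF that] by (simp add: quotient_algebra_sel)
  qed (simp_all add: coset_closed V.act_closed V.act_add V.act_smult V.add_act V.smult_act
      V.mult_act coset_add[symmetric] coset_mult[symmetric] coset_smult[symmetric])
qed

text \<open>Every element of the quotient is the coset of some element of \<open>A\<close>, so both
  algebras leave the same subspaces invariant.\<close>

lemma irreducible_pullback:
  assumes "irreducible_representation K Q V \<psi>"
  shows "irreducible_representation K A V (\<lambda>a. \<psi> (I +>\<^bsub>A\<^esub> a))"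
proof -
  interpret V: irreducible_representation K Q V \<psi> by fact
  show ?thesis
  proof (intro irreducible_representation.intro irreducible_representation_axioms.intro
      representation_pullback V.representation_axioms V.nonzero)
    fix W assume W: "submodule W K V"
      and st: "\<And>a w. a \<in> carrier A \<Longrightarrow> w \<in> W \<Longrightarrow> \<psi> (I +>\<^bsub>A\<^esub> a) w \<in> W"
    show "W = {\<zero>\<^bsub>V\<^esub>} \<or> W = carrier V"
    proof (rule V.no_invariant_subspace[OF W])
      fix C w assume "C \<in> carrier Q" "w \<in> W"
      then show "\<psi> C w \<in> W"
        using st by (elim coset_cases) simp
    qed
  qed
qed

context
  fixes V :: "('k, 'v, 'e) module_scheme" and \<phi> :: "'a \<Rightarrow> 'v \<Rightarrow> 'v"
  assumes rep: "representation K A V \<phi>"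
    and kills: "\<And>a v. a \<in> I \<Longrightarrow> v \<in> carrier V \<Longrightarrow> \<phi> a v = \<zero>\<^bsub>V\<^esub>"
begin

interpretation V: representation K A V \<phi>
  by (rule rep)

text \<open>The chosen representative is \<open>i \<oplus> a\<close> with \<open>i\<close> in the
  ideal, and the summand \<open>i\<close> acts as zero.\<close>

lemma quotient_act_coset:
  assumes a: "a \<in> carrier A" and v: "v \<in> carrier V"
  shows "quotient_act \<phi> (I +>\<^bsub>A\<^esub> a) v = \<phi> a v"
proof -
  define b where "b = (SOME b. b \<in> I +>\<^bsub>A\<^esub> a)"
  have "b \<in> I +>\<^bsub>A\<^esub> a"
    unfolding b_def using coset_self[OF a] by (rule someI)
  then obtain i where i: "i \<in> I" "b = i \<oplus>\<^bsub>A\<^esub> a"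
    by (rule coset_memE)
  then show ?thesis
    using a v by (simp add: quotient_act_def b_def[symmetric] V.add_act kills Icarr V.act_closed)
qed

lemma representation_quotient_act: "representation K Q V (quotient_act \<phi>)"
proof (intro representation.intro representation_axioms.intro K.field_axioms representation.axioms(2)[OF rep])
  show "quotient_act \<phi> \<one>\<^bsub>Q\<^esub> v = v" if "v \<in> carrier V" for v
    using that by (simp add: quotient_algebra_sel quotient_act_coset V.one_act)
qed (auto elim!: coset_cases simp: quotient_act_coset coset_add coset_mult coset_smult
    V.act_closed V.act_add V.act_smult V.add_act V.smult_act V.mult_act)

end

lemma irreducible_quotient_act:
  assumes irr: "irreducible_representation K A V \<phi>"
    and kills: "\<And>a v. a \<in> I \<Longrightarrow> v \<in> carrier V \<Longrightarrow> \<phi> a v = \<zero>\<^bsub>V\<^esub>"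
  shows "irreducible_representation K Q V (quotient_act \<phi>)"
proof -
  interpret V: irreducible_representation K A V \<phi> by fact
  note rep = V.representation_axioms
  show ?thesis
  proof (intro irreducible_representation.intro irreducible_representation_axioms.intro
      representation_quotient_act rep kills V.nonzero)
    fix W assume W: "submodule W K V"
      and st: "\<And>C w. C \<in> carrier Q \<Longrightarrow> w \<in> W \<Longrightarrow> quotient_act \<phi> C w \<in> W"
    show "W = {\<zero>\<^bsub>V\<^esub>} \<or> W = carrier V"
    proof (rule V.no_invariant_subspace[OF W])
      fix a w assume aw: "a \<in> carrier A" "w \<in> W"
      then have "w \<in> carrier V"
        using V.submoduleE(1)[OF W] by blast
      then show "\<phi> a w \<in> W"
        using st[OF coset_closed[OF aw(1)] aw(2)] quotient_act_coset[OF rep kills aw(1)] by simp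
    qed
  qed
qed

text \<open>An element of the ideal has the same coset as zero, so an action that factors must kill
  it; conversely \<open>quotient_act\<close> is the factorization.\<close>

lemma factors_through_quotient_iff:
  assumes rep: "representation K A V \<phi>"
  shows "factors_through_quotient K A I V \<phi> \<longleftrightarrow> (\<forall>a\<in>I. \<forall>v\<in>carrier V. \<phi> a v = \<zero>\<^bsub>V\<^esub>)"
proof
  interpret V: representation K A V \<phi> by fact
  assume "factors_through_quotient K A I V \<phi>"
  then obtain \<psi> where \<psi>: "\<And>a v. a \<in> carrier A \<Longrightarrow> v \<in> carrier V \<Longrightarrow> \<psi> (I +>\<^bsub>A\<^esub> a) v = \<phi> a v"
    unfolding factors_through_quotient_def by blast
  show "\<forall>a\<in>I. \<forall>v\<in>carrier V. \<phi> a v = \<zero>\<^bsub>V\<^esub>"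
  proof (intro ballI)
    fix a v assume a: "a \<in> I" and v: "v \<in> carrier V"
    have "I +>\<^bsub>A\<^esub> a = I +>\<^bsub>A\<^esub> \<zero>\<^bsub>A\<^esub>"
      using coset_eqI[of "\<zero>\<^bsub>A\<^esub>" a] a by (simp add: Icarr)
    then have "\<phi> a v = \<phi> \<zero>\<^bsub>A\<^esub> v"
      using \<psi>[of a v] \<psi>[of "\<zero>\<^bsub>A\<^esub>" v] a v by (simp add: Icarr)
    \<comment> \<open>Writing the zero of the algebra as a multiple by the scalar 0 lets linearity
      show that it acts as zero.\<close>
    also have "\<dots> = \<phi> (\<zero>\<^bsub>K\<^esub> \<odot>\<^bsub>A\<^esub> \<zero>\<^bsub>A\<^esub>) v"
      by simp
    also have "\<dots> = \<zero>\<^bsub>V\<^esub>"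
      using v by (subst V.smult_act) (simp_all add: V.act_closed)
    finally show "\<phi> a v = \<zero>\<^bsub>V\<^esub>" .
  qed
next
  assume kills: "\<forall>a\<in>I. \<forall>v\<in>carrier V. \<phi> a v = \<zero>\<^bsub>V\<^esub>"
  show "factors_through_quotient K A I V \<phi>"
    unfolding factors_through_quotient_def
    using representation_quotient_act[OF rep] quotient_act_coset[OF rep] kills
    by (intro exI[of _ "quotient_act \<phi>"]) simp
qed

text \<open>The same linear bijection works over both algebras, because a coset acts as its elements
  do. This carries distinctness and exhaustiveness over to the quotient.\<close>

lemma rep_equivalent_quotient_iff:
  assumes "\<And>a v. a \<in> carrier A \<Longrightarrow> v \<in> carrier V \<Longrightarrow> \<psi> (I +>\<^bsub>A\<^esub> a) v = \<phi> a v"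
    and "\<And>a w. a \<in> carrier A \<Longrightarrow> w \<in> carrier W \<Longrightarrow> \<psi>' (I +>\<^bsub>A\<^esub> a) w = \<phi>' a w"
  shows "rep_equivalent K Q V \<psi> W \<psi>' \<longleftrightarrow> rep_equivalent K A V \<phi> W \<phi>'"
proof -
  have "(\<forall>C\<in>carrier Q. \<forall>v\<in>carrier V. T (\<psi> C v) = \<psi>' C (T v))
      \<longleftrightarrow> (\<forall>a\<in>carrier A. \<forall>v\<in>carrier V. T (\<phi> a v) = \<phi>' a (T v))"
    if "bij_betw T (carrier V) (carrier W)" for T
  proof -
    have "T v \<in> carrier W" if "v \<in> carrier V" for v
      using \<open>bij_betw T _ _\<close> that bij_betwE by blast
    then have "(\<forall>v\<in>carrier V. T (\<psi> (I +>\<^bsub>A\<^esub> a) v) = \<psi>' (I +>\<^bsub>A\<^esub> a) (T v))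
        \<longleftrightarrow> (\<forall>v\<in>carrier V. T (\<phi> a v) = \<phi>' a (T v))" if "a \<in> carrier A" for a
      using assms that by simp
    then show ?thesis
      by (metis coset_cases coset_closed)
  qed
  then show ?thesis
    unfolding rep_equivalent_def by blast
qed

text \<open>Factoring means that the ideal acts as zero, and an intertwiner preserves this: it is
  onto and sends zero to zero.\<close>

lemma factors_through_quotient_equivalent:
  assumes rep: "representation K Q V \<psi>"
    and eq: "rep_equivalent K A V (\<lambda>a. \<psi> (I +>\<^bsub>A\<^esub> a)) W \<phi>"
    and W: "representation K A W \<phi>"
  shows "factors_through_quotient K A I W \<phi>"
proof -
  interpret V: representation K Q V \<psi> by fact
  interpret W: representation K A W \<phi> by fact
  have kills: "\<psi> (I +>\<^bsub>A\<^esub> a) v = \<zero>\<^bsub>V\<^esub>" if "a \<in> I" "v \<in> carrier V" for a v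
  proof -
    have "factors_through_quotient K A I V (\<lambda>a. \<psi> (I +>\<^bsub>A\<^esub> a))"
      unfolding factors_through_quotient_def using rep by blast
    then show ?thesis
      using that unfolding factors_through_quotient_iff[OF representation_pullback[OF rep]] by blast
  qed
  obtain T where T: "bij_betw T (carrier V) (carrier W)"
    "\<And>c v. c \<in> carrier K \<Longrightarrow> v \<in> carrier V \<Longrightarrow> T (c \<odot>\<^bsub>V\<^esub> v) = c \<odot>\<^bsub>W\<^esub> T v"
    "\<And>a v. a \<in> carrier A \<Longrightarrow> v \<in> carrier V \<Longrightarrow> T (\<psi> (I +>\<^bsub>A\<^esub> a) v) = \<phi> a (T v)"
    using eq unfolding rep_equivalent_def by blast
  have TW: "T v \<in> carrier W" if "v \<in> carrier V" for v
    using T(1) that bij_betwE by blast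
  have T0: "T \<zero>\<^bsub>V\<^esub> = \<zero>\<^bsub>W\<^esub>"
    using T(2)[of "\<zero>\<^bsub>K\<^esub>" "\<zero>\<^bsub>V\<^esub>"] TW[OF V.M.zero_closed] by simp
  show ?thesis
    unfolding factors_through_quotient_iff[OF W]
  proof (intro ballI)
    fix a w assume a: "a \<in> I" and "w \<in> carrier W"
    then obtain v where v: "v \<in> carrier V" "w = T v"
      using T(1) by (auto simp: bij_betw_def)
    then show "\<phi> a w = \<zero>\<^bsub>W\<^esub>"
      using T(3)[OF Icarr[OF a] v(1)] kills[OF a v(1)] T0 by simp
  qed
qed

end

section \<open>The one-dimensional representations attached to subsets\<close>

locale kiselman_over_field = K?: field K for K :: "('k, 'c) ring_scheme" + fixes n :: nat
begin

sublocale coefficients_and_monoid K "kiselman n"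
  by (intro coefficients_and_monoid.intro K.is_cring monoid_kiselman)

lemma rho_closed [simp]: "rho K n X w \<in> carrier K"
  by (simp add: rho_def)

text \<open>A union of contents lies in \<open>X\<close> exactly when both contents do, so the
  indicator is multiplicative.\<close>

lemma rho_mult:
  "x \<in> carrier (kiselman n) \<Longrightarrow> y \<in> carrier (kiselman n)
    \<Longrightarrow> rho K n X (x \<otimes>\<^bsub>kiselman n\<^esub> y) = rho K n X x \<otimes>\<^bsub>K\<^esub> rho K n X y"
  by (simp add: rho_def content_mult)

lemma rho_one: "rho K n X \<one>\<^bsub>kiselman n\<^esub> = \<one>\<^bsub>K\<^esub>"
  by (simp add: rho_def content_one)

abbreviation rho_ext where "rho_ext X \<equiv> linear_extension K (kiselman n) (rho K n X)"

lemma rho_ext_closed: "f \<in> carrier A \<Longrightarrow> rho_ext X f \<in> carrier K"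
  by (simp add: linear_extension_closed)

lemma rho_ext_add:
  "f \<in> carrier A \<Longrightarrow> g \<in> carrier A \<Longrightarrow> rho_ext X (f \<oplus>\<^bsub>A\<^esub> g) = rho_ext X f \<oplus>\<^bsub>K\<^esub> rho_ext X g"
  by (simp add: linear_extension_add)

lemma rho_ext_smult:
  "c \<in> carrier K \<Longrightarrow> f \<in> carrier A \<Longrightarrow> rho_ext X (c \<odot>\<^bsub>A\<^esub> f) = c \<otimes>\<^bsub>K\<^esub> rho_ext X f"
  by (simp add: linear_extension_smult)

lemma rho_ext_basis:
  "w \<in> carrier (kiselman n) \<Longrightarrow> rho_ext X (basis_elem K (kiselman n) w) = rho K n X w"
  by (simp add: linear_extension_basis)

text \<open>In the iterated extension the inner function is \<open>rho K n X\<close> times a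
  constant. Pulling the constant out of the inner extension, and then the value of the inner
  extension out of the outer one, leaves the product.\<close>

lemma rho_ext_mult:
  assumes f: "f \<in> carrier A" and g: "g \<in> carrier A"
  shows "rho_ext X (f \<otimes>\<^bsub>A\<^esub> g) = rho_ext X f \<otimes>\<^bsub>K\<^esub> rho_ext X g"
proof -
  have inner: "linear_extension K (kiselman n) (\<lambda>z. rho K n X (y \<otimes>\<^bsub>kiselman n\<^esub> z)) g
      = rho K n X y \<otimes>\<^bsub>K\<^esub> rho_ext X g" if y: "y \<in> carrier (kiselman n)" for y
  proof -
    have "linear_extension K (kiselman n) (\<lambda>z. rho K n X (y \<otimes>\<^bsub>kiselman n\<^esub> z)) g
        = linear_extension K (kiselman n) (\<lambda>z. rho K n X z \<otimes>\<^bsub>K\<^esub> rho K n X y) g"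
      using g by (rule linear_extension_cong) (simp_all add: rho_mult y K.m_comm)
    also have "\<dots> = rho_ext X g \<otimes>\<^bsub>K\<^esub> rho K n X y"
      using g by (rule linear_extension_fun_mult) simp_all
    finally show ?thesis
      using g by (simp add: K.m_comm rho_ext_closed)
  qed
  have "rho_ext X (f \<otimes>\<^bsub>A\<^esub> g)
      = linear_extension K (kiselman n) (\<lambda>y. linear_extension K (kiselman n)
          (\<lambda>z. rho K n X (y \<otimes>\<^bsub>kiselman n\<^esub> z)) g) f"
    using f g by (rule linear_extension_mult) simp
  also have "\<dots> = linear_extension K (kiselman n) (\<lambda>y. rho K n X y \<otimes>\<^bsub>K\<^esub> rho_ext X g) f"
    using f by (rule linear_extension_cong) (simp_all add: inner rho_ext_closed g)
  also have "\<dots> = rho_ext X f \<otimes>\<^bsub>K\<^esub> rho_ext X g"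
    using f by (rule linear_extension_fun_mult) (simp_all add: rho_ext_closed g)
  finally show ?thesis .
qed

lemma rho_ext_A_one: "rho_ext X \<one>\<^bsub>A\<^esub> = \<one>\<^bsub>K\<^esub>"
  using rho_ext_basis[of "\<one>\<^bsub>kiselman n\<^esub>" X] by (simp add: one_monoid_algebra rho_one)

lemma representation_rho: "representation K A (self_module K) (rho_rep K n X)"
  by (intro representation.intro representation_axioms.intro K.field_axioms
      module_self_module[OF K.field_axioms])
    (simp_all add: rho_rep_def rho_ext_closed rho_ext_add rho_ext_smult rho_ext_mult
      rho_ext_A_one K.r_distr K.l_distr K.m_lcomm K.m_assoc)

text \<open>A subspace of the field with a nonzero \<open>w\<close> contains every \<open>x\<close>,
  as \<open>x\<close> is the multiple of \<open>w\<close> by \<open>x\<close> times the inverse of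
  \<open>w\<close>.\<close>

lemma irreducible_rho: "irreducible_representation K A (self_module K) (rho_rep K n X)"
proof (intro irreducible_representation.intro irreducible_representation_axioms.intro
    representation_rho)
  show "carrier (self_module K) \<noteq> {\<zero>\<^bsub>self_module K\<^esub>}"
    using K.one_not_zero K.one_closed unfolding self_module_simps by blast
  fix W assume W: "submodule W K (self_module K)"
  note WE = module.submoduleE[OF module_self_module[OF K.field_axioms] W, unfolded self_module_simps]
  show "W = {\<zero>\<^bsub>self_module K\<^esub>} \<or> W = carrier (self_module K)"
  proof (cases "W \<subseteq> {\<zero>\<^bsub>K\<^esub>}")
    case True
    then show ?thesis
      using WE(2) unfolding self_module_simps by blast
  next
    case False
    then obtain w where w: "w \<in> W" "w \<noteq> \<zero>\<^bsub>K\<^esub>"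
      by blast
    have "x \<in> W" if x: "x \<in> carrier K" for x
    proof -
      have wK: "w \<in> carrier K"
        using w WE(1) by blast
      have "inv\<^bsub>K\<^esub> w \<in> carrier K" "inv\<^bsub>K\<^esub> w \<otimes>\<^bsub>K\<^esub> w = \<one>\<^bsub>K\<^esub>"
        using w wK by (simp_all add: K.field_Units)
      then show ?thesis
        using WE(4)[of "x \<otimes>\<^bsub>K\<^esub> inv\<^bsub>K\<^esub> w" w] x w wK by (simp add: K.m_assoc)
    qed
    then show ?thesis
      using WE(1) unfolding self_module_simps by blast
  qed
qed

text \<open>A generator whose index lies in just one of \<open>X\<close> and \<open>Y\<close> acts
  as the identity on one side and as zero on the other. An intertwiner would then send 1 to 0,
  against injectivity.\<close>

lemma not_rep_equivalent_rho:
  assumes X: "X \<subseteq> {1..n}" and Y: "Y \<subseteq> {1..n}" and "X \<noteq> Y"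
  shows "\<not> rep_equivalent K A (self_module K) (rho_rep K n X) (self_module K) (rho_rep K n Y)"
proof
  assume "rep_equivalent K A (self_module K) (rho_rep K n X) (self_module K) (rho_rep K n Y)"
  then obtain T where bij: "bij_betw T (carrier K) (carrier K)"
    and smult: "\<And>c v. c \<in> carrier K \<Longrightarrow> v \<in> carrier K \<Longrightarrow> T (c \<otimes>\<^bsub>K\<^esub> v) = c \<otimes>\<^bsub>K\<^esub> T v"
    and act: "\<And>a v. a \<in> carrier A \<Longrightarrow> v \<in> carrier K \<Longrightarrow> T (rho_rep K n X a v) = rho_rep K n Y a (T v)"
    unfolding rep_equivalent_def self_module_simps by blast
  obtain i where i: "i \<in> {1..n}" "i \<in> X \<longleftrightarrow> i \<notin> Y"
    using assms by blast
  define w where "w = word_class n [i]"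
  have w: "w \<in> carrier (kiselman n)" "content n w = {i}"
    using i(1) by (simp_all add: w_def word_class_closed content_word_class del: One_nat_def)
  have T1: "T \<one>\<^bsub>K\<^esub> \<in> carrier K"
    using bij by (auto simp: bij_betw_def)
  have "rho K n X w \<otimes>\<^bsub>K\<^esub> T \<one>\<^bsub>K\<^esub> = rho K n Y w \<otimes>\<^bsub>K\<^esub> T \<one>\<^bsub>K\<^esub>"
    using act[OF basis_elem_closed[of w] K.one_closed] smult[of "rho K n X w" "\<one>\<^bsub>K\<^esub>"] w(1)
    by (simp add: rho_rep_def rho_ext_basis)
  then have "T \<one>\<^bsub>K\<^esub> = \<zero>\<^bsub>K\<^esub>"
    using i(2) w(2) T1 by (cases "i \<in> X") (simp_all add: rho_def)
  moreover have "T \<zero>\<^bsub>K\<^esub> = \<zero>\<^bsub>K\<^esub>"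
    using smult[of "\<zero>\<^bsub>K\<^esub>" "\<one>\<^bsub>K\<^esub>"] T1 by simp
  ultimately have "\<one>\<^bsub>K\<^esub> = \<zero>\<^bsub>K\<^esub>"
    using inj_onD[OF bij_betw_imp_inj_on[OF bij], of "\<one>\<^bsub>K\<^esub>" "\<zero>\<^bsub>K\<^esub>"] by simp
  then show False
    by simp
qed

section \<open>Classification of the irreducible representations\<close>

context
  fixes V :: "('k, 'v, 'e) module_scheme" and \<phi> :: "(nat list set \<Rightarrow> 'k) \<Rightarrow> 'v \<Rightarrow> 'v"
  assumes irr: "irreducible_representation K A V \<phi>"
begin

interpretation V: irreducible_representation K A V \<phi>
  by (rule irr)

abbreviation act where "act w \<equiv> \<phi> (basis_elem K (kiselman n) w)"

lemma act_closed: "v \<in> carrier V \<Longrightarrow> act w v \<in> carrier V"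
  by (simp add: V.act_closed basis_elem_closed)

lemma act_act:
  "x \<in> carrier (kiselman n) \<Longrightarrow> y \<in> carrier (kiselman n) \<Longrightarrow> v \<in> carrier V
    \<Longrightarrow> act x (act y v) = act (x \<otimes>\<^bsub>kiselman n\<^esub> y) v"
  by (simp add: V.mult_act[symmetric] basis_elem_closed basis_elem_mult)

lemma act_words:
  "u \<in> lists {1..n} \<Longrightarrow> u' \<in> lists {1..n} \<Longrightarrow> v \<in> carrier V
    \<Longrightarrow> act (word_class n u) (act (word_class n u') v) = act (word_class n (u @ u')) v"
  by (simp only: act_act word_class_closed kiselman_mult)

lemma act_nil: "v \<in> carrier V \<Longrightarrow> act (word_class n []) v = v"
  using V.one_act[of v] by (simp add: one_monoid_algebra kiselman_one)

lemma act_linear: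
  "v \<in> carrier V \<Longrightarrow> v' \<in> carrier V \<Longrightarrow> act w (v \<oplus>\<^bsub>V\<^esub> v') = act w v \<oplus>\<^bsub>V\<^esub> act w v'"
  "c \<in> carrier K \<Longrightarrow> v \<in> carrier V \<Longrightarrow> act w (c \<odot>\<^bsub>V\<^esub> v) = c \<odot>\<^bsub>V\<^esub> act w v"
  by (simp_all add: V.act_add V.act_smult basis_elem_closed)

lemma phi_zero:
  assumes "v \<in> carrier V" shows "\<phi> \<zero>\<^bsub>A\<^esub> v = \<zero>\<^bsub>V\<^esub>"
  using V.smult_act[of "\<zero>\<^bsub>K\<^esub>" "\<zero>\<^bsub>A\<^esub>" v] assms by (simp add: V.act_closed A_zero_closed)

lemma act_zero: "act w \<zero>\<^bsub>V\<^esub> = \<zero>\<^bsub>V\<^esub>"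
  using act_linear(2)[of "\<zero>\<^bsub>K\<^esub>" "\<zero>\<^bsub>V\<^esub>" w] by (simp add: act_closed)

text \<open>Invariance under the generators passes to words by induction on their length, and from
  there to linear combinations because \<open>W\<close> is a subspace. So irreducibility can be
  tested on generators.\<close>

lemma generators_invariant:
  assumes W: "submodule W K V"
    and gen: "\<And>i w. i \<in> {1..n} \<Longrightarrow> w \<in> W \<Longrightarrow> act (word_class n [i]) w \<in> W"
  shows "W = {\<zero>\<^bsub>V\<^esub>} \<or> W = carrier V"
proof (rule V.no_invariant_subspace[OF W])
  note WE = V.submoduleE[OF W]
  have zero: "\<zero>\<^bsub>V\<^esub> \<in> W"
    using WE(2) WE(4)[of "\<zero>\<^bsub>K\<^esub>"] WE(1) by (metis K.zero_closed V.smult_l_null ex_in_conv subsetD)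
  have word: "w \<in> W \<Longrightarrow> act (word_class n u) w \<in> W" if "u \<in> lists {1..n}" for u w
    using that
  proof (induction u arbitrary: w)
    case Nil
    then show ?case
      using WE(1) by (simp add: act_nil subset_iff)
  next
    case (Cons i u)
    have i: "i \<in> {1..n}" "[i] \<in> lists {1..n}"
      using Cons.hyps by auto
    have "act (word_class n [i]) (act (word_class n u) w) \<in> W"
      by (intro gen i Cons.IH Cons.prems)
    then show ?case
      using act_words[OF i(2) Cons.hyps(2), of w] WE(1) Cons.prems by (simp add: subset_iff)
  qed
  fix f w assume "f \<in> carrier A" and w: "w \<in> W"
  have wV: "w \<in> carrier V"
    using w WE(1) by blast
  from \<open>f \<in> carrier A\<close> show "\<phi> f w \<in> W"
  proof (induction rule: monoid_algebra_induct)
    case zero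
    then show ?case
      by (simp only: phi_zero[OF wV] \<open>\<zero>\<^bsub>V\<^esub> \<in> W\<close>)
  next
    case (smult c x)
    then obtain u where "u \<in> lists {1..n}" "x = word_class n u"
      unfolding kiselman_carrier_iff by blast
    then show ?case
      using smult(1) word[of u w] w wV WE(4) by (simp only: V.smult_act basis_elem_closed)
  next
    case (add f g)
    then show ?case
      using WE(5) wV by (simp only: V.add_act)
  qed
qed

text \<open>If every \<open>a\<^sub>j\<close> with \<open>j < i\<close> acts by a scalar, then the image of \<open>a\<^sub>i\<close> is invariant, because
  \<open>a\<^sub>j a\<^sub>i = a\<^sub>i a\<^sub>j a\<^sub>i\<close> for \<open>j > i\<close>.\<close>

lemma generator_zero_or_identity:
  assumes "i \<in> {1..n}"
  shows "(\<forall>v\<in>carrier V. act (word_class n [i]) v = v)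
    \<or> (\<forall>v\<in>carrier V. act (word_class n [i]) v = \<zero>\<^bsub>V\<^esub>)"
  using assms
proof (induction i rule: less_induct)
  case (less i)
  let ?g = "\<lambda>i. act (word_class n [i])"
  define W where "W = ?g i ` carrier V"
  have i: "[i] \<in> lists {1..n}"
    using less.prems by simp
  have "submodule W K V"
  proof (rule V.submoduleI)
    show "W \<subseteq> carrier V"
      by (auto simp: W_def act_closed)
    show "\<zero>\<^bsub>V\<^esub> \<in> W"
      unfolding W_def using act_zero by (metis V.M.zero_closed imageI)
    show smult: "c \<odot>\<^bsub>V\<^esub> w \<in> W" if "c \<in> carrier K" "w \<in> W" for c w
      using that by (auto simp: W_def act_linear(2)[symmetric])
    show "w \<oplus>\<^bsub>V\<^esub> w' \<in> W" if "w \<in> W" "w' \<in> W" for w w'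
      using that by (auto simp: W_def act_linear(1)[symmetric])
    show "\<ominus>\<^bsub>V\<^esub> w \<in> W" if "w \<in> W" for w
      using smult[of "\<ominus>\<^bsub>K\<^esub> \<one>\<^bsub>K\<^esub>" w] that \<open>W \<subseteq> carrier V\<close> by (auto simp: V.smult_l_minus)
  qed
  moreover have "?g j w \<in> W" if j: "j \<in> {1..n}" and w: "w \<in> W" for j w
  proof -
    have jl: "[j] \<in> lists {1..n}"
      using j by simp
    obtain v where v: "v \<in> carrier V" "w = ?g i v"
      using w unfolding W_def by blast
    show ?thesis
    proof (cases "j < i")
      case True
      have "?g j w = w \<or> ?g j w = \<zero>\<^bsub>V\<^esub>"
        using less.IH[OF True j] act_closed[OF v(1)] v(2) by blast
      moreover have "\<zero>\<^bsub>V\<^esub> \<in> W"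
        unfolding W_def using act_zero by (metis V.M.zero_closed imageI)
      ultimately show ?thesis
        using w by auto
    next
      case False
      \<comment> \<open>For \<open>j = i\<close> this identity comes from idempotence, so that case
        can be treated together with \<open>j > i\<close>.\<close>
      have "word_class n [j, i] = word_class n ([i] @ [j, i])"
      proof (cases "j = i")
        case True
        have "word_class n ([i] @ [i, i]) = word_class n [i] \<otimes>\<^bsub>kiselman n\<^esub> word_class n [i, i]"
          using less.prems by (intro kiselman_mult[symmetric]) simp_all
        also have "word_class n [i, i] = word_class n [i]"
          using less.prems by (intro word_class_rel) (simp add: kiselman_rels_def)
        also have "word_class n [i] \<otimes>\<^bsub>kiselman n\<^esub> word_class n [i] = word_class n [i, i]"
          using less.prems by (subst kiselman_mult) simp_all
        finally show ?thesis
          using True by simp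
      next
        case neq: False
        have "([i, j, i], [j, i]) \<in> kiselman_rels n"
          using neq False j less.prems unfolding kiselman_rels_def by auto
        then show ?thesis
          by (simp add: word_class_rel)
      qed
      then have "?g j w = ?g i (act (word_class n [j, i]) v)"
        using act_words[OF jl i v(1)] act_words[OF i _ v(1), of "[j, i]"] i jl v(2) by simp
      then show ?thesis
        unfolding W_def using act_closed[OF v(1)] by blast
    qed
  qed
  ultimately have "W = {\<zero>\<^bsub>V\<^esub>} \<or> W = carrier V"
    by (rule generators_invariant)
  then show ?case
  proof
    assume "W = {\<zero>\<^bsub>V\<^esub>}"
    then show ?case
      unfolding W_def by blast
  next
    assume W: "W = carrier V"
    \<comment> \<open>A surjective idempotent map is the identity.\<close>
    have "?g i w = w" if w: "w \<in> carrier V" for w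
    proof -
      obtain v where v: "v \<in> carrier V" "w = ?g i v"
        using w W unfolding W_def by blast
      have "word_class n [i, i] = word_class n [i]"
        using less.prems by (intro word_class_rel) (simp add: kiselman_rels_def)
      then show ?thesis
        using act_words[OF i i v(1)] v(2) by simp
    qed
    then show ?case
      by blast
  qed
qed

text \<open>The set \<open>X\<close> for which the given representation turns out to be
  \<open>rho_X\<close>; by the dichotomy, the generators outside it act as zero.\<close>

definition identity_generators where
  "identity_generators = {i \<in> {1..n}. \<forall>v\<in>carrier V. act (word_class n [i]) v = v}"

text \<open>A word acts as the composition of its letters, so a single letter acting as zero kills
  it. Hence only the set of letters matters, which is how the content enters.\<close>

lemma act_word:
  assumes "u \<in> lists {1..n}" and v: "v \<in> carrier V"
  shows "act (word_class n u) v = (if set u \<subseteq> identity_generators then v else \<zero>\<^bsub>V\<^esub>)"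
  using assms(1)
proof (induction u)
  case Nil
  then show ?case
    using v by (simp add: act_nil)
next
  case (Cons i u)
  have i: "[i] \<in> lists {1..n}"
    using Cons.hyps by simp
  have split: "act (word_class n (i # u)) v = act (word_class n [i]) (act (word_class n u) v)"
    using act_words[OF i Cons.hyps(2) v] by simp
  show ?case
  proof (cases "i \<in> identity_generators")
    case True
    then have "act (word_class n [i]) w = w" if "w \<in> carrier V" for w
      using that unfolding identity_generators_def by blast
    then show ?thesis
      unfolding split using act_closed[OF v] Cons.IH True v by simp
  next
    case False
    then have "act (word_class n [i]) w = \<zero>\<^bsub>V\<^esub>" if "w \<in> carrier V" for w
      using generator_zero_or_identity[OF Cons.hyps(1)] Cons.hyps(1) that
      unfolding identity_generators_def by blast
    then show ?thesis
      unfolding split using act_closed[OF v] False by simp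
  qed
qed

text \<open>Both sides are linear in \<open>f\<close>, and on basis elements they agree because the
  content of a class is the letter set of any of its words. In particular the whole algebra acts by
  scalars.\<close>

lemma phi_rho_ext:
  assumes "f \<in> carrier A" and v: "v \<in> carrier V"
  shows "\<phi> f v = rho_ext identity_generators f \<odot>\<^bsub>V\<^esub> v"
  using assms(1)
proof (induction rule: monoid_algebra_induct)
  case zero
  have "rho_ext identity_generators \<zero>\<^bsub>A\<^esub> = \<zero>\<^bsub>K\<^esub>"
    using rho_ext_smult[of "\<zero>\<^bsub>K\<^esub>" "\<zero>\<^bsub>A\<^esub>"] by (simp add: A_zero_closed rho_ext_closed)
  then show ?case
    using v by (simp add: phi_zero)
next
  case (smult c w)
  then obtain u where u: "u \<in> lists {1..n}" "w = word_class n u"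
    unfolding kiselman_carrier_iff by blast
  have "act w v = rho K n identity_generators w \<odot>\<^bsub>V\<^esub> v"
    using v unfolding u(2) rho_def content_word_class[OF u(1)] act_word[OF u(1) v] by simp
  then show ?case
    using smult v by (simp add: V.smult_act basis_elem_closed rho_ext_smult rho_ext_basis
        V.smult_assoc1)
next
  case (add f g)
  then show ?case
    using v by (simp add: V.add_act rho_ext_add rho_ext_closed V.smult_l_distr)
qed

text \<open>Under an action by scalars every line is invariant, so \<open>V\<close> is spanned by
  any nonzero vector \<open>v\<close>.\<close>

lemma irreducible_equivalent_rho:
  "rep_equivalent K A V \<phi> (self_module K) (rho_rep K n identity_generators)"
proof -
  obtain v where v: "v \<in> carrier V" "v \<noteq> \<zero>\<^bsub>V\<^esub>"
    using V.nonzero V.M.zero_closed by blast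
  define W where "W = (\<lambda>c. c \<odot>\<^bsub>V\<^esub> v) ` carrier K"
  have "submodule W K V"
  proof (rule V.submoduleI)
    show "W \<subseteq> carrier V"
      using v by (auto simp: W_def)
    show "\<zero>\<^bsub>V\<^esub> \<in> W"
      unfolding W_def using v by (intro image_eqI[of _ _ "\<zero>\<^bsub>K\<^esub>"]) simp_all
    show smult: "c \<odot>\<^bsub>V\<^esub> w \<in> W" if "c \<in> carrier K" "w \<in> W" for c w
      using that v by (auto simp: W_def V.smult_assoc1[symmetric])
    show "w \<oplus>\<^bsub>V\<^esub> w' \<in> W" if "w \<in> W" "w' \<in> W" for w w'
      using that v by (auto simp: W_def V.smult_l_distr[symmetric])
    show "\<ominus>\<^bsub>V\<^esub> w \<in> W" if "w \<in> W" for w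
      using smult[of "\<ominus>\<^bsub>K\<^esub> \<one>\<^bsub>K\<^esub>" w] that \<open>W \<subseteq> carrier V\<close> by (auto simp: V.smult_l_minus)
  qed
  moreover have "\<phi> f w \<in> W" if f: "f \<in> carrier A" and w: "w \<in> W" for f w
  proof -
    obtain c where c: "c \<in> carrier K" "w = c \<odot>\<^bsub>V\<^esub> v"
      using w unfolding W_def by blast
    then have "\<phi> f w = (rho_ext identity_generators f \<otimes>\<^bsub>K\<^esub> c) \<odot>\<^bsub>V\<^esub> v"
      using f v by (simp add: phi_rho_ext V.smult_assoc1 rho_ext_closed)
    then show ?thesis
      unfolding W_def using c f
      by (intro image_eqI[of _ _ "rho_ext identity_generators f \<otimes>\<^bsub>K\<^esub> c"])
        (simp_all add: rho_ext_closed)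
  qed
  ultimately have "W = {\<zero>\<^bsub>V\<^esub>} \<or> W = carrier V"
    by (rule V.no_invariant_subspace)
  moreover have "v \<in> W"
    unfolding W_def using v by (intro image_eqI[of _ _ "\<one>\<^bsub>K\<^esub>"]) simp_all
  ultimately have im: "W = carrier V"
    using v(2) by blast
  \<comment> \<open>If two different scalars agree on \<open>v\<close>, their difference
    \<open>e\<close> kills \<open>v\<close>; applying the inverse of \<open>e\<close> would give
    \<open>v\<close> zero.\<close>
  have "inj_on (\<lambda>c. c \<odot>\<^bsub>V\<^esub> v) (carrier K)"
  proof (rule inj_onI, rule ccontr)
    fix c d assume cd: "c \<in> carrier K" "d \<in> carrier K" "c \<odot>\<^bsub>V\<^esub> v = d \<odot>\<^bsub>V\<^esub> v" "c \<noteq> d"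
    define e where "e = c \<ominus>\<^bsub>K\<^esub> d"
    have "e \<oplus>\<^bsub>K\<^esub> d = c"
      using cd(1,2) by (simp add: e_def a_minus_def K.a_assoc K.l_neg)
    then have e: "e \<in> carrier K" "e \<noteq> \<zero>\<^bsub>K\<^esub>"
      using cd(1,2,4) by (auto simp: e_def)
    have "e \<odot>\<^bsub>V\<^esub> v = \<zero>\<^bsub>V\<^esub>"
      using cd v by (simp add: e_def a_minus_def V.smult_l_distr V.smult_l_minus V.M.r_neg)
    moreover have "inv\<^bsub>K\<^esub> e \<in> carrier K" "inv\<^bsub>K\<^esub> e \<otimes>\<^bsub>K\<^esub> e = \<one>\<^bsub>K\<^esub>"
      using e by (simp_all add: K.field_Units)
    ultimately have "v = \<zero>\<^bsub>V\<^esub>"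
      using V.smult_assoc1[of "inv\<^bsub>K\<^esub> e" e v] e v by simp
    then show False
      using v(2) by simp
  qed
  \<comment> \<open>The explicit isomorphism goes from the field to \<open>V\<close>, so the desired
    direction is obtained by symmetry.\<close>
  then have "rep_equivalent K A (self_module K) (rho_rep K n identity_generators) V \<phi>"
    unfolding rep_equivalent_def using im v
    by (intro exI[of _ "\<lambda>c. c \<odot>\<^bsub>V\<^esub> v"])
      (auto simp: bij_betw_def W_def V.smult_l_distr V.smult_assoc1 rho_rep_def phi_rho_ext rho_ext_closed)
  then show ?thesis
    by (rule rep_equivalent_sym[OF representation_rho])
qed

end

lemma irreducible_exhaustive:
  assumes "irreducible_representation K A V \<phi>"
  shows "\<exists>X. X \<subseteq> {1..n} \<and> rep_equivalent K A V \<phi> (self_module K) (rho_rep K n X)"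
  using irreducible_equivalent_rho[OF assms] identity_generators_def[OF assms] by blast

section \<open>The quotient by the zero element, and the counts\<close>

abbreviation Z where "Z \<equiv> Idl\<^bsub>A\<^esub> {basis_elem K (kiselman n) (kiselman_zero n)}"

lemma ideal_Z: "ideal Z A"
  by (rule genideal_ideal) (simp add: basis_elem_closed)

sublocale bar: algebra_ideal K A Z
proof (intro algebra_ideal.intro algebra_ideal_axioms.intro K.field_axioms module_axioms ideal_Z)
  interpret Z: ideal Z A
    by (rule ideal_Z)
  fix c a assume c: "c \<in> carrier K" and a: "a \<in> Z"
  \<comment> \<open>Multiplication by a scalar is multiplication by an element of the algebra, so a
    ring ideal is a subspace.\<close>
  have "c \<odot>\<^bsub>A\<^esub> a = (c \<odot>\<^bsub>A\<^esub> \<one>\<^bsub>A\<^esub>) \<otimes>\<^bsub>A\<^esub> a"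
    using c a by (simp add: smult_mult A_l_one A_one_closed Z.Icarr)
  then show "c \<odot>\<^bsub>A\<^esub> a \<in> Z"
    using c a by (simp add: Z.I_l_closed A_smult_closed A_one_closed)
qed

lemma rho_ext_zero: "rho_ext X \<zero>\<^bsub>A\<^esub> = \<zero>\<^bsub>K\<^esub>"
  using rho_ext_smult[of "\<zero>\<^bsub>K\<^esub>" "\<zero>\<^bsub>A\<^esub>" X] by (simp add: A_zero_closed rho_ext_closed)

text \<open>The kernel of a multiplicative linear functional. As an ideal it contains all of
  \<open>Z\<close> as soon as it contains the generator of \<open>Z\<close>.\<close>

lemma ideal_ker_rho_ext: "ideal {f \<in> carrier A. rho_ext X f = \<zero>\<^bsub>K\<^esub>} A"
proof (rule idealI)
  let ?N = "{f \<in> carrier A. rho_ext X f = \<zero>\<^bsub>K\<^esub>}"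
  show "subgroup ?N (add_monoid A)"
  proof (rule add.subgroupI)
    fix f assume f: "f \<in> ?N"
    have "rho_ext X (\<ominus>\<^bsub>A\<^esub> f) = \<zero>\<^bsub>K\<^esub>"
      using rho_ext_smult[of "\<ominus>\<^bsub>K\<^esub> \<one>\<^bsub>K\<^esub>" f X] f by (simp add: smult_l_minus)
    then show "\<ominus>\<^bsub>A\<^esub> f \<in> ?N"
      using f by simp
  qed (auto simp: rho_ext_add rho_ext_zero)
qed (auto simp: rho_ext_mult rho_ext_closed ring_axioms)

text \<open>The zero element has content \<open>{1..n}\<close>, so \<open>rho_X\<close> takes the
  value 1 on it for the full set and 0 for every proper subset. In the latter case the kernel is an
  ideal containing the generator, hence \<open>Z\<close>.\<close>

lemma rho_kills_Z_iff:
  assumes X: "X \<subseteq> {1..n}"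
  shows "(\<forall>a\<in>Z. \<forall>v\<in>carrier (self_module K). rho_rep K n X a v = \<zero>\<^bsub>self_module K\<^esub>)
    \<longleftrightarrow> X \<noteq> {1..n}"
proof
  let ?z = "basis_elem K (kiselman n) (kiselman_zero n)"
  have z: "rho_ext X ?z = (if {1..n} \<subseteq> X then \<one>\<^bsub>K\<^esub> else \<zero>\<^bsub>K\<^esub>)"
    by (simp only: rho_ext_basis kiselman_zero_closed rho_def content_kiselman_zero)
  have zZ: "?z \<in> Z"
    by (intro genideal_self' basis_elem_closed)
  {
    assume "\<forall>a\<in>Z. \<forall>v\<in>carrier (self_module K). rho_rep K n X a v = \<zero>\<^bsub>self_module K\<^esub>"
    \<comment> \<open>Applying the generator of \<open>Z\<close> to the vector 1 recovers the scalar
      by which it acts.\<close>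
    then have "rho_ext X ?z \<otimes>\<^bsub>K\<^esub> \<one>\<^bsub>K\<^esub> = \<zero>\<^bsub>K\<^esub>"
      using zZ unfolding rho_rep_def self_module_simps by (meson K.one_closed)
    then show "X \<noteq> {1..n}"
      unfolding z by (auto split: if_splits)
  next
    assume "X \<noteq> {1..n}"
    then have "rho_ext X ?z = \<zero>\<^bsub>K\<^esub>"
      unfolding z using X by auto
    then have "Z \<subseteq> {f \<in> carrier A. rho_ext X f = \<zero>\<^bsub>K\<^esub>}"
      by (intro genideal_minimal ideal_ker_rho_ext) (simp add: basis_elem_closed)
    then show "\<forall>a\<in>Z. \<forall>v\<in>carrier (self_module K). rho_rep K n X a v = \<zero>\<^bsub>self_module K\<^esub>"
      unfolding rho_rep_def self_module_simps by (auto simp: subset_iff)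
  }
qed

lemma rho_factors_iff:
  "X \<subseteq> {1..n} \<Longrightarrow> factors_through_quotient K A Z (self_module K) (rho_rep K n X) \<longleftrightarrow> X \<noteq> {1..n}"
  using bar.factors_through_quotient_iff[OF representation_rho] rho_kills_Z_iff by simp

lemma card_irreps:
  assumes "carrier K \<lesssim> (UNIV :: 'v set)"
  shows "card (irrep_classes K A TYPE('v)) = 2 ^ n"
proof -
  have "card (irrep_classes K A TYPE('v)) = card (Pow {1..n})"
  proof (rule card_irrep_classes)
    show "\<exists>X\<in>Pow {1..n}. rep_equivalent K A V \<phi> (self_module K) (rho_rep K n X)"
      if "irreducible_representation K A V \<phi>" for V :: "('k, 'v) module" and \<phi>
      using irreducible_exhaustive[OF that] by blast
  qed (use assms irreducible_rho not_rep_equivalent_rho in \<open>simp_all only: self_module_simps Pow_iff simp_thms not_False_eq_True\<close>)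
  then show ?thesis
    by (simp add: card_Pow)
qed

text \<open>Pulled back to the full algebra, an irreducible representation of the quotient is one on
  which \<open>Z\<close> acts as zero. So the list for the quotient is the full list without the
  entry \<open>X = {1..n}\<close>.\<close>

lemma card_irreps_bar:
  assumes "carrier K \<lesssim> (UNIV :: 'v set)"
  shows "card (irrep_classes K (quotient_algebra A Z) TYPE('v)) = 2 ^ n - 1"
proof -
  let ?r = "\<lambda>X. quotient_act (rho_rep K n X)"
  let ?J = "Pow {1..n} - {{1..n}}"
  have kills: "rho_rep K n X a v = \<zero>\<^bsub>self_module K\<^esub>"
    if "X \<in> ?J" "a \<in> Z" "v \<in> carrier (self_module K)" for X a v
    using rho_kills_Z_iff[of X] that by blast
  have act: "?r X (Z +>\<^bsub>A\<^esub> a) v = rho_rep K n X a v"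
    if "X \<in> ?J" "a \<in> carrier A" "v \<in> carrier (self_module K)" for X a v
    by (rule bar.quotient_act_coset[OF representation_rho kills[OF that(1)] that(2,3)])
  have "card (irrep_classes K (quotient_algebra A Z) TYPE('v)) = card ?J"
  proof (rule card_irrep_classes)
    show "irreducible_representation K (quotient_algebra A Z) (self_module K) (?r X)"
      if "X \<in> ?J" for X
      by (rule bar.irreducible_quotient_act[OF irreducible_rho kills[OF that]])
    show "\<not> rep_equivalent K (quotient_algebra A Z) (self_module K) (?r X) (self_module K) (?r Y)"
      if "X \<in> ?J" "Y \<in> ?J" "X \<noteq> Y" for X Y
    proof -
      have "rep_equivalent K (quotient_algebra A Z) (self_module K) (?r X) (self_module K) (?r Y)
          \<longleftrightarrow> rep_equivalent K A (self_module K) (rho_rep K n X) (self_module K) (rho_rep K n Y)"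
        by (rule bar.rep_equivalent_quotient_iff) (simp_all only: act that)
      moreover have "\<not> rep_equivalent K A (self_module K) (rho_rep K n X) (self_module K) (rho_rep K n Y)"
        using that by (intro not_rep_equivalent_rho) blast+
      ultimately show ?thesis
        by simp
    qed
    show "\<exists>X\<in>?J. rep_equivalent K (quotient_algebra A Z) V \<psi> (self_module K) (?r X)"
      if irr: "irreducible_representation K (quotient_algebra A Z) V \<psi>"
      for V :: "('k, 'v) module" and \<psi>
    proof -
      let ?\<phi> = "\<lambda>a. \<psi> (Z +>\<^bsub>A\<^esub> a)"
      have irrA: "irreducible_representation K A V ?\<phi>"
        by (rule bar.irreducible_pullback[OF irr])
      obtain X where X: "X \<subseteq> {1..n}"
        and eq: "rep_equivalent K A V ?\<phi> (self_module K) (rho_rep K n X)"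
        using irreducible_exhaustive[OF irrA] by blast
      have rep: "representation K (quotient_algebra A Z) V \<psi>"
        by (rule irreducible_representation.axioms(1)[OF irr])
      \<comment> \<open>The pullback kills \<open>Z\<close>, hence so does the equivalent
        \<open>rho_X\<close>; this rules out the full set.\<close>
      have "factors_through_quotient K A Z (self_module K) (rho_rep K n X)"
        by (rule bar.factors_through_quotient_equivalent[OF rep eq representation_rho])
      then have "X \<noteq> {1..n}"
        using rho_factors_iff[OF X] by blast
      have J: "X \<in> ?J"
        using X \<open>X \<noteq> {1..n}\<close> by blast
      have "rep_equivalent K (quotient_algebra A Z) V \<psi> (self_module K) (?r X)
          \<longleftrightarrow> rep_equivalent K A V ?\<phi> (self_module K) (rho_rep K n X)"
        by (rule bar.rep_equivalent_quotient_iff) (simp_all only: act J)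
      then show ?thesis
        using eq J by blast
    qed
    show "carrier (self_module K) \<lesssim> (UNIV :: 'v set)"
      using assms by simp
  qed
  also have "card ?J = card (Pow {1..n}) - 1"
    by (rule card_Diff_singleton) blast
  finally show ?thesis
    by (simp add: card_Pow)
qed

end

theorem proposition36:
  fixes K :: "'k ring" and n :: nat
  assumes "field K" and "n \<ge> 1"
  shows
    "(\<forall>X. X \<subseteq> {1..n} \<longrightarrow>
        irreducible_representation K (kiselman_algebra K n) (self_module K) (rho_rep K n X))
   \<and> ((\<forall>X Y. X \<subseteq> {1..n} \<and> Y \<subseteq> {1..n} \<and> X \<noteq> Y \<longrightarrow>
          \<not> rep_equivalent K (kiselman_algebra K n)
              (self_module K) (rho_rep K n X) (self_module K) (rho_rep K n Y))
      \<and> (\<forall>(V :: ('k, 'v) module) \<phi>.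
          irreducible_representation K (kiselman_algebra K n) V \<phi> \<longrightarrow>
          (\<exists>X. X \<subseteq> {1..n} \<and>
             rep_equivalent K (kiselman_algebra K n) V \<phi> (self_module K) (rho_rep K n X)))
      \<and> (carrier K \<lesssim> (UNIV :: 'v set) \<longrightarrow>
          card (irrep_classes K (kiselman_algebra K n) TYPE('v)) = 2 ^ n))
   \<and> ((\<forall>X. X \<subseteq> {1..n} \<longrightarrow>
          (factors_through_quotient K (kiselman_algebra K n) (zero_ideal K n)
              (self_module K) (rho_rep K n X)
            \<longleftrightarrow> X \<noteq> {1..n}))
      \<and> (carrier K \<lesssim> (UNIV :: 'v set) \<longrightarrow>
          card (irrep_classes K (kiselman_algebra_bar K n) TYPE('v)) = 2 ^ n - 1))"
proof -
  interpret kiselman_over_field K n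
    using assms(1) by (rule kiselman_over_field.intro)
  \<comment> \<open>The facts of the locale are phrased with the monoid algebra \<open>A\<close> and
    the generated ideal \<open>Z\<close>, which these names abbreviate.\<close>
  note unfolds = kiselman_algebra_bar_def zero_ideal_def kiselman_algebra_def
  show ?thesis
    unfolding unfolds
    using irreducible_rho not_rep_equivalent_rho irreducible_exhaustive card_irreps
      rho_factors_iff card_irreps_bar
    by blast
qed

end
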